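(* Let $n\ge 2$, let $\beta>0$ and $h\in\mathbb{R}$, and let $M\ge 1$ be an integer bounded by a polynomial in $n$. Then the Flat-swap Markov chain for the ferromagnetic mean-field Ising model with inverse temperature $\beta$ and external field $h$ (defined in the context) mixes polynomially: its mixing time $\tau(\varepsilon)$ is bounded above by a polynomial in $n$ and $\log(1/\varepsilon)$.
   Context: Mean-field Ising model: $V=\{1,\dots,n\}$ (complete graph), configurations $x\in\Omega=\{+1,-1\}^V$. For $x\in\Omega$ let $k(x)$ be the number of vertices with spin $+1$. The Gibbs distribution at inverse temperature $b\ge 0$ with field $h$ is $\pi_{b,h}(x)=\exp\big(b(\sum_{i<j}\delta_{x_i,x_j}+h\,k(x))\big)/Z(b,h)$, with $Z(b,h)$ the normalizing constant. Entropy dampening distributions: for $i=0,\dots,M$ let $\beta_i=i\beta/M$, $f_i(x)=\binom{n}{k(x)}^{(i-M)/M}$, and $\rho_i(x)=\pi_{\beta_i,h}(x)f_i(x)/Z_i$, where $Z_i=\sum_{x}\pi_{\beta_i,h}(x)f_i(x)$. For a distribution $\rho$ on $\Omega$, the Metropolis chain $M_\rho$ proposes, from $x$, the configuration $y$ obtained by choosing a uniformly random vertex and a uniformly random spin and setting that vertex to that spin; the move is accepted with probability $\min(1,\rho(y)/\rho(x))$, otherwise the chain stays at $x$. Flat-swap chain: state space $\Omega^{M+1}$, states $x=(x_0,\dots,x_M)$, stationary distribution $\prod_i\rho_i(x_i)$. Each step chooses uniformly between two move types. Level move: choose $i\in\{0,\dots,M\}$ uniformly and update $x_i$ by one step of $M_{\rho_i}$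 (so the probability of moving to $x'$ differing only in coordinate $i$ is $\frac{1}{2(M+1)}M_{\rho_i}(x_i,x_i')$). Swap move: choose $i\in\{0,\dots,M-1\}$ uniformly and let $x'$ be $x$ with coordinates $i$ and $i+1$ exchanged; move to $x'$ with probability $\frac{1}{2M}\min\big(1,\frac{\rho_{i+1}(x_i)\rho_i(x_{i+1})}{\rho_i(x_i)\rho_{i+1}(x_{i+1})}\big)$. Mixing time: $\tau(\varepsilon)=\min\{t:\max_x\frac12\sum_y|P^{t'}(x,y)-\pi(y)|\le\varepsilon\ \forall t'\ge t\}$ for transition matrix $P$ with stationary distribution $\pi$. *)

theory Defs
  imports "HOL-Probability.Probability" "HOL-Computational_Algebra.Polynomial"
begin

definition configs :: "nat \<Rightarrow> (nat \<Rightarrow> int) set" where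
  "configs n = {1..n} \<rightarrow>\<^sub>E {1, -1}"

definition num_plus :: "nat \<Rightarrow> (nat \<Rightarrow> int) \<Rightarrow> nat" where
  "num_plus n x = card {v \<in> {1..n}. x v = 1}"

definition gibbs_weight :: "nat \<Rightarrow> real \<Rightarrow> real \<Rightarrow> (nat \<Rightarrow> int) \<Rightarrow> real" where
  "gibbs_weight n b h x =
     exp (b * ((\<Sum>(u, v)\<in>{(u, v). u \<in> {1..n} \<and> v \<in> {1..n} \<and> u < v}. of_bool (x u = x v))
               + h * real (num_plus n x)))"

definition gibbs :: "nat \<Rightarrow> real \<Rightarrow> real \<Rightarrow> (nat \<Rightarrow> int) \<Rightarrow> real" where
  "gibbs n b h x = gibbs_weight n b h x / (\<Sum>y\<in>configs n. gibbs_weight n b h y)"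

definition dampening :: "nat \<Rightarrow> nat \<Rightarrow> nat \<Rightarrow> (nat \<Rightarrow> int) \<Rightarrow> real" where
  "dampening n M i x = real (n choose num_plus n x) powr ((real i - real M) / real M)"

definition damped_gibbs :: "nat \<Rightarrow> nat \<Rightarrow> real \<Rightarrow> real \<Rightarrow> nat \<Rightarrow> (nat \<Rightarrow> int) \<Rightarrow> real" where
  "damped_gibbs n M \<beta> h i x =
     (let \<beta>\<^sub>i = real i * \<beta> / real M in
      gibbs n \<beta>\<^sub>i h x * dampening n M i x
        / (\<Sum>y\<in>configs n. gibbs n \<beta>\<^sub>i h y * dampening n M i y))"

definition metropolis ::
    "nat \<Rightarrow> ((nat \<Rightarrow> int) \<Rightarrow> real) \<Rightarrow> (nat \<Rightarrow> int) \<Rightarrow> (nat \<Rightarrow> int) pmf" where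
  "metropolis n \<rho> x = do {
     v \<leftarrow> pmf_of_set {1..n};
     s \<leftarrow> pmf_of_set {1, -1};
     let y = x(v := s);
     accept \<leftarrow> bernoulli_pmf (min 1 (\<rho> y / \<rho> x));
     return_pmf (if accept then y else x)
   }"

definition flat_swap_states :: "nat \<Rightarrow> nat \<Rightarrow> (nat \<Rightarrow> nat \<Rightarrow> int) set" where
  "flat_swap_states n M = {0..M} \<rightarrow>\<^sub>E configs n"

definition flat_swap_dist ::
    "nat \<Rightarrow> nat \<Rightarrow> real \<Rightarrow> real \<Rightarrow> (nat \<Rightarrow> nat \<Rightarrow> int) \<Rightarrow> real" where
  "flat_swap_dist n M \<beta> h x = (\<Prod>i=0..M. damped_gibbs n M \<beta> h i (x i))"

definition level_move ::
    "nat \<Rightarrow> nat \<Rightarrow> real \<Rightarrow> real \<Rightarrow> (nat \<Rightarrow> nat \<Rightarrow> int) \<Rightarrow> (nat \<Rightarrow> nat \<Rightarrow> int) pmf" where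
  "level_move n M \<beta> h x = do {
     i \<leftarrow> pmf_of_set {0..M};
     y \<leftarrow> metropolis n (damped_gibbs n M \<beta> h i) (x i);
     return_pmf (x(i := y))
   }"

text \<open>For \<open>M = 0\<close> there is no pair of adjacent levels and \<open>pmf_of_set {0..<M}\<close> is
  unspecified; the chain is meant for \<open>M \<ge> 1\<close> only.\<close>

definition swap_move ::
    "nat \<Rightarrow> nat \<Rightarrow> real \<Rightarrow> real \<Rightarrow> (nat \<Rightarrow> nat \<Rightarrow> int) \<Rightarrow> (nat \<Rightarrow> nat \<Rightarrow> int) pmf" where
  "swap_move n M \<beta> h x = do {
     i \<leftarrow> pmf_of_set {0..<M};
     let \<rho> = damped_gibbs n M \<beta> h;
     accept \<leftarrow> bernoulli_pmf
       (min 1 ((\<rho> (i + 1) (x i) * \<rho> i (x (i + 1))) / (\<rho> i (x i) * \<rho> (i + 1) (x (i + 1)))));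
     return_pmf (if accept then x(i := x (i + 1), i + 1 := x i) else x)
   }"

definition flat_swap ::
    "nat \<Rightarrow> nat \<Rightarrow> real \<Rightarrow> real \<Rightarrow> (nat \<Rightarrow> nat \<Rightarrow> int) \<Rightarrow> (nat \<Rightarrow> nat \<Rightarrow> int) pmf" where
  "flat_swap n M \<beta> h x = do {
     level \<leftarrow> bernoulli_pmf (1 / 2);
     if level then level_move n M \<beta> h x else swap_move n M \<beta> h x
   }"

definition chain_after :: "('s \<Rightarrow> 's pmf) \<Rightarrow> nat \<Rightarrow> 's \<Rightarrow> 's pmf" where
  "chain_after K t x = ((\<lambda>\<mu>. bind_pmf \<mu> K) ^^ t) (return_pmf x)"

definition tv_distance :: "'s set \<Rightarrow> 's pmf \<Rightarrow> ('s \<Rightarrow> real) \<Rightarrow> real" where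
  "tv_distance S \<mu> \<pi> = 1 / 2 * (\<Sum>y\<in>S. \<bar>pmf \<mu> y - \<pi> y\<bar>)"

text \<open>The minimum is taken in \<^typ>\<open>enat\<close>, so that it is \<open>\<infinity>\<close> for a chain that never comes
  within \<open>\<epsilon>\<close> of \<open>\<pi>\<close>. The state set \<open>S\<close> is assumed to be finite, nonempty
  and closed under \<open>K\<close>.\<close>

definition mixing_time :: "'s set \<Rightarrow> ('s \<Rightarrow> 's pmf) \<Rightarrow> ('s \<Rightarrow> real) \<Rightarrow> real \<Rightarrow> enat" where
  "mixing_time S K \<pi> \<epsilon> =
     Inf {enat t | t. \<forall>t'\<ge>t. (MAX x\<in>S. tv_distance S (chain_after K t' x) \<pi>) \<le> \<epsilon>}"

text \<open>A polynomial in two variables is an element of \<^typ>\<open>real poly poly\<close>.\<close>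

definition poly_eval2 :: "real poly poly \<Rightarrow> real \<Rightarrow> real \<Rightarrow> real" where
  "poly_eval2 p a b = poly (poly p [:a:]) b"

end

theory Submission
  imports Defs
begin

text \<open>Writing \<open>k(x)\<close> for the number of plus spins, \<open>\<rho>\<^sub>i(x)\<close> is proportional to
  \<open>exp (i G(k(x)) / M) / (n choose k(x))\<close> with \<open>G\<close> the log-weight of a layer at the lowest
  temperature. The chain has a spectral gap that is polynomial in \<open>n\<close> and \<open>M\<close> for every \<open>G\<close>:
  level \<open>0\<close> is uniform on layers and relaxes fast, \<open>\<rho>\<^sub>j \<le> (n + 1) \<rho>\<^sub>0\<close> lets coordinate
  \<open>j\<close> be resampled through coordinate \<open>0\<close>, and a long-range swap is a product of adjacent swaps
  along which the stationary weight never drops below that of the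
  lighter end point.

  The gap alone does not suffice, since the smallest stationary weight is not bounded in terms of
  \<open>n\<close> and \<open>M\<close> uniformly in \<open>\<beta>\<close> and \<open>h\<close>. But a gap of size at least \<open>L\<close> between values of
  \<open>G\<close> is seen by the chain only through acceptance probabilities within \<open>n exp (- L / M)\<close> of
  \<open>0\<close> or \<open>1\<close>. Shrinking all such gaps to \<open>L\<close> changes the kernel by a negligible amount and
  makes the range of \<open>G\<close> at most \<open>(n + 1) L\<close>; the modified chain mixes fast from every state, hence
  so does the original one.\<close>

section \<open>Metropolis chains generated by involutions\<close>

text \<open>The gap does not depend on \<open>G\<close> because the exponent of
  \<open>\<rho>\<^sub>i\<close> is linear in \<open>i\<close>: in a swap ratio the normalizations
  and the binomials cancel, and whether a swap gains weight depends only on which of the two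
  configurations has the larger potential. A swap towards sorted order therefore never loses weight,
  however far apart the levels are. Composing swaps multiplies the constant at every stage, so a
  long swap is split at its midpoint; the depth is then logarithmic in \<open>M\<close> and the loss
  is a power of \<open>M\<close>.

  Shrinking the gaps of \<open>G\<close> involves a circular requirement: the time that the modified
  chain needs grows linearly with \<open>L\<close>, since its smallest weight is exponentially small
  in \<open>L\<close>, while the discrepancy accumulated over that time must stay below
  \<open>\<epsilon>\<close>. The discrepancy per step decays like \<open>exp (- L / M)\<close>, so
  \<open>L\<close> equal to \<open>M\<close> times a logarithm satisfies both demands.

  All estimates concern test functions acted on by the transition operator; laws and total variation
  enter only when the kernel is identified.\<close>

locale metropolis_involutions =
  fixes S :: "'s set" and I :: "'e set" and act :: "'e \<Rightarrow> 's \<Rightarrow> 's"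
    and c :: "'e \<Rightarrow> real" and w :: "'s \<Rightarrow> real"
  assumes finite_S: "finite S" and finite_I: "finite I"
    and act_in: "e \<in> I \<Longrightarrow> x \<in> S \<Longrightarrow> act e x \<in> S"
    and act_act: "e \<in> I \<Longrightarrow> x \<in> S \<Longrightarrow> act e (act e x) = x"
    and c_nonneg: "e \<in> I \<Longrightarrow> 0 \<le> c e" and sum_c: "sum c I \<le> 3 / 4"
    and w_pos: "x \<in> S \<Longrightarrow> 0 < w x" and sum_w: "sum w S = 1"
begin

definition acc :: "'e \<Rightarrow> 's \<Rightarrow> real" where
  "acc e x = min 1 (w (act e x) / w x)"

definition step :: "('s \<Rightarrow> real) \<Rightarrow> 's \<Rightarrow> real" where
  "step f x = f x + (\<Sum>e\<in>I. c e * acc e x * (f (act e x) - f x))"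

definition mean :: "('s \<Rightarrow> real) \<Rightarrow> real" where
  "mean f = (\<Sum>x\<in>S. w x * f x)"

text \<open>Twice the Dirichlet form of the edges of \<open>e\<close>, since the sum meets every
  edge from both ends.\<close>

definition energy :: "'e \<Rightarrow> ('s \<Rightarrow> real) \<Rightarrow> real" where
  "energy e f = (\<Sum>x\<in>S. min (w x) (w (act e x)) * (f x - f (act e x))\<^sup>2)"

definition var :: "('s \<Rightarrow> real) \<Rightarrow> real" where
  "var f = mean (\<lambda>x. (f x - mean f)\<^sup>2)"

lemma acc_bounds: "x \<in> S \<Longrightarrow> e \<in> I \<Longrightarrow> 0 \<le> acc e x" "acc e x \<le> 1"
  using w_pos[of x] w_pos[of "act e x"] act_in[of e x] by (auto simp: acc_def)

lemma w_acc: "x \<in> S \<Longrightarrow> w x * acc e x = min (w x) (w (act e x))"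
  using w_pos[of x] by (auto simp: acc_def min_def field_simps)

lemma sum_act:
  assumes "e \<in> I" shows "(\<Sum>x\<in>S. h (act e x)) = (\<Sum>x\<in>S. h x)"
  by (rule sum.reindex_bij_witness[where i = "act e" and j = "act e"])
     (use assms in \<open>auto simp: act_in act_act\<close>)

text \<open>Detailed balance: the flux \<open>min (w x) (w (act e x))\<close> is invariant under the
  involution, so reindexing by \<open>act e\<close> cancels gain against loss.\<close>

lemma mean_step: "mean (step f) = mean f"
proof -
  have "(\<Sum>x\<in>S. w x * (\<Sum>e\<in>I. c e * acc e x * (f (act e x) - f x))) = 
    (\<Sum>x\<in>S. \<Sum>e\<in>I. c e * (w x * acc e x * (f (act e x) - f x)))"
    by (simp add: sum_distrib_left algebra_simps)
  also have "\<dots> = (\<Sum>e\<in>I. c e * (\<Sum>x\<in>S. min (w x) (w (act e x)) * (f (act e x) - f x)))"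
    by (subst sum.swap) (simp add: sum_distrib_left w_acc)
  also have "\<dots> = 0"
  proof (intro sum.neutral ballI)
    fix e assume e: "e \<in> I"
    have "(\<Sum>x\<in>S. min (w x) (w (act e x)) * f (act e x)) 
        = (\<Sum>x\<in>S. min (w (act e (act e x))) (w (act e x)) * f (act e x))"
      using e by (intro sum.cong) (auto simp: act_act)
    also have "\<dots> = (\<Sum>x\<in>S. min (w (act e x)) (w x) * f x)"
      by (rule sum_act[OF e, where h = "\<lambda>x. min (w (act e x)) (w x) * f x"])
    finally show "c e * (\<Sum>x\<in>S. min (w x) (w (act e x)) * (f (act e x) - f x)) = 0"
      by (simp add: right_diff_distrib sum_subtractf min.commute)
  qed
  finally show ?thesis by (simp add: mean_def step_def algebra_simps sum.distrib)
qed

lemma mean_iter: "mean ((step ^^ t) f) = mean f"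
  by (induction t) (simp_all add: mean_step)

lemma mean_mono: "(\<And>x. x \<in> S \<Longrightarrow> f x \<le> g x) \<Longrightarrow> mean f \<le> mean g"
  unfolding mean_def by (intro sum_mono mult_left_mono) (auto intro: less_imp_le w_pos)

lemma mean_cong: "(\<And>x. x \<in> S \<Longrightarrow> f x = g x) \<Longrightarrow> mean f = mean g"
  unfolding mean_def by (intro sum.cong) auto

lemma mean_add: "mean (\<lambda>x. f x + g x) = mean f + mean g"
  by (simp add: mean_def sum.distrib algebra_simps)

lemma mean_diff: "mean (\<lambda>x. f x - g x) = mean f - mean g"
  by (simp add: mean_def sum_subtractf algebra_simps)

lemma mean_cmult: "mean (\<lambda>x. a * f x) = a * mean f"
  by (simp add: mean_def sum_distrib_left algebra_simps)

lemma mean_const: "mean (\<lambda>x. a) = a"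
  using sum_w by (simp add: mean_def flip: sum_distrib_right)

lemma var_eq: "var f = mean (\<lambda>x. (f x)\<^sup>2) - (mean f)\<^sup>2"
proof -
  have "var f = mean (\<lambda>x. ((f x)\<^sup>2 - (2 * mean f) * f x) + (mean f)\<^sup>2)"
    unfolding var_def by (rule mean_cong) (simp add: power2_eq_square algebra_simps)
  also have "\<dots> = mean (\<lambda>x. (f x)\<^sup>2) - (2 * mean f) * mean f + (mean f)\<^sup>2"
    by (simp only: mean_add mean_diff mean_cmult mean_const)
  finally show ?thesis by (simp add: power2_eq_square)
qed

text \<open>Comparing two independent samples removes the mean, which is the form produced by
  \<open>tensorization\<close>.\<close>

lemma var_eq_double_sum:
  "2 * var f = (\<Sum>x\<in>S. \<Sum>y\<in>S. w x * w y * (f x - f y)\<^sup>2)"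
proof -
  have "(\<Sum>x\<in>S. \<Sum>y\<in>S. w x * w y * (f x - f y)\<^sup>2)
    = mean (\<lambda>x. mean (\<lambda>y. ((f x)\<^sup>2 - (2 * f x) * f y) + (f y)\<^sup>2))"
    by (simp add: mean_def sum_distrib_left power2_eq_square algebra_simps)
  also have "\<dots> = mean (\<lambda>x. ((f x)\<^sup>2 - (2 * mean f) * f x) + mean (\<lambda>y. (f y)\<^sup>2))"
    by (rule mean_cong) (simp only: mean_add mean_diff mean_cmult mean_const, simp)
  also have "\<dots> = mean (\<lambda>x. (f x)\<^sup>2) - (2 * mean f) * mean f + mean (\<lambda>x. (f x)\<^sup>2)"
    by (simp only: mean_add mean_diff mean_cmult mean_const)
  finally show ?thesis unfolding var_eq by (simp add: power2_eq_square)
qed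

lemma sum_p_le: "x \<in> S \<Longrightarrow> (\<Sum>e\<in>I. c e * acc e x) \<le> 3 / 4"
proof -
  assume x: "x \<in> S"
  have "(\<Sum>e\<in>I. c e * acc e x) \<le> sum c I"
    by (intro sum_mono mult_left_le) (auto simp: acc_bounds c_nonneg)
  with sum_c show ?thesis by simp
qed

lemma p_nonneg: "x \<in> S \<Longrightarrow> e \<in> I \<Longrightarrow> 0 \<le> c e * acc e x"
  by (simp add: acc_bounds c_nonneg)

text \<open>Each state is held with probability at least \<open>1/4\<close>, so the conditional variance of
  one step is at least a quarter of the mean squared jump.\<close>

lemma step_square:
  assumes x: "x \<in> S"
  shows "(step f x)\<^sup>2 \<le> step (\<lambda>x. (f x)\<^sup>2) x - 1 / 4 * (\<Sum>e\<in>I. c e * acc e x * (f x - f (act e x))\<^sup>2)"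
proof -
  define p where "p e = c e * acc e x" for e
  define d where "d e = f (act e x) - f x" for e
  have p0: "p e \<ge> 0" if "e \<in> I" for e using p_nonneg[OF x that] by (simp add: p_def)
  have P: "sum p I \<le> 3 / 4" using sum_p_le[OF x] by (simp add: p_def)
  define Q where "Q = (\<Sum>e\<in>I. p e * (d e)\<^sup>2)"
  have Q0: "Q \<ge> 0" unfolding Q_def by (intro sum_nonneg) (auto simp: p0)
  have "(\<Sum>e\<in>I. p e * d e)\<^sup>2 = (\<Sum>e\<in>I. sqrt (p e) * (sqrt (p e) * d e))\<^sup>2"
    by (rule arg_cong[where f = "\<lambda>z. z\<^sup>2"], rule sum.cong) (auto simp: p0)
  also have "\<dots> \<le> (\<Sum>e\<in>I. (sqrt (p e))\<^sup>2) * (\<Sum>e\<in>I. (sqrt (p e) * d e)\<^sup>2)"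
    by (rule Cauchy_Schwarz_ineq_sum)
  also have "\<dots> = sum p I * Q"
    unfolding Q_def by (auto simp: p0 power_mult_distrib)
  also have "\<dots> \<le> 3 / 4 * Q" using P Q0 by (rule mult_right_mono)
  finally have CS: "(\<Sum>e\<in>I. p e * d e)\<^sup>2 \<le> 3 / 4 * Q" .
  have "step (\<lambda>x. (f x)\<^sup>2) x = (f x)\<^sup>2 + (\<Sum>e\<in>I. p e * ((d e)\<^sup>2 + 2 * f x * d e))"
    unfolding step_def by (simp add: p_def d_def power2_eq_square algebra_simps)
  also have "\<dots> = (f x)\<^sup>2 + Q + 2 * f x * (\<Sum>e\<in>I. p e * d e)"
    by (simp add: Q_def sum.distrib sum_distrib_left algebra_simps)
  finally have 1: "step (\<lambda>x. (f x)\<^sup>2) x = (f x)\<^sup>2 + Q + 2 * f x * (\<Sum>e\<in>I. p e * d e)" .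
  have 2: "(step f x)\<^sup>2 = (f x)\<^sup>2 + 2 * f x * (\<Sum>e\<in>I. p e * d e) + (\<Sum>e\<in>I. p e * d e)\<^sup>2"
    unfolding step_def by (simp add: p_def d_def power2_eq_square algebra_simps)
  have 3: "(\<Sum>e\<in>I. c e * acc e x * (f x - f (act e x))\<^sup>2) = Q"
    by (simp add: Q_def p_def d_def power2_commute)
  show ?thesis unfolding 1 2 3 using CS by simp
qed

lemma var_step: "var (step f) \<le> var f - 1 / 4 * (\<Sum>e\<in>I. c e * energy e f)"
proof -
  have "mean (\<lambda>x. (step f x)\<^sup>2) \<le> 
    mean (\<lambda>x. step (\<lambda>x. (f x)\<^sup>2) x - 1 / 4 * (\<Sum>e\<in>I. c e * acc e x * (f x - f (act e x))\<^sup>2))"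
    by (intro mean_mono step_square)
  also have "\<dots> = mean (\<lambda>x. (f x)\<^sup>2) - 1 / 4 * mean (\<lambda>x. \<Sum>e\<in>I. c e * acc e x * (f x - f (act e x))\<^sup>2)"
    by (simp only: mean_diff mean_cmult mean_step)
  also have "mean (\<lambda>x. \<Sum>e\<in>I. c e * acc e x * (f x - f (act e x))\<^sup>2)
     = (\<Sum>x\<in>S. \<Sum>e\<in>I. c e * (w x * acc e x * (f x - f (act e x))\<^sup>2))"
    unfolding mean_def by (simp add: sum_distrib_left algebra_simps)
  also have "\<dots> = (\<Sum>e\<in>I. c e * energy e f)"
    by (subst sum.swap) (simp add: sum_distrib_left w_acc energy_def)
  finally show ?thesis unfolding var_eq by (simp add: mean_step)
qed

lemma var_iter:
  assumes poincare: "\<And>f. var f \<le> \<Lambda> * (\<Sum>e\<in>I. c e * energy e f)" and "\<Lambda> \<ge> 1"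
  shows "var ((step ^^ t) f) \<le> (1 - 1 / (4 * \<Lambda>)) ^ t * var f"
proof (induction t)
  case (Suc t)
  let ?g = "(step ^^ t) f"
  have "var ?g / \<Lambda> \<le> (\<Sum>e\<in>I. c e * energy e ?g)"
    using poincare[of ?g] \<open>\<Lambda> \<ge> 1\<close> by (simp add: field_simps)
  with var_step[of ?g] have "var (step ?g) \<le> (1 - 1 / (4 * \<Lambda>)) * var ?g"
    by (simp add: algebra_simps)
  also have "\<dots> \<le> (1 - 1 / (4 * \<Lambda>)) * ((1 - 1 / (4 * \<Lambda>)) ^ t * var f)"
    using \<open>\<Lambda> \<ge> 1\<close> by (intro mult_left_mono Suc) (auto simp: field_simps)
  finally show ?case by (simp add: mult_ac)
qed auto

lemma mean_abs_le: "(\<And>x. x \<in> S \<Longrightarrow> \<bar>f x\<bar> \<le> b) \<Longrightarrow> \<bar>mean f\<bar> \<le> b"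
  using mean_mono[of f "\<lambda>_. b"] mean_mono[of "\<lambda>_. - b" f] 
  unfolding mean_const by (auto simp: abs_le_iff minus_le_iff)

text \<open>Keeping only the term of \<open>x\<close> in the variance turns decay in mean square
  into a pointwise bound. The price is \<open>1 / w x\<close>, and this is the one place where the
  smallest weight matters.\<close>

lemma iter_converges:
  assumes poincare: "\<And>f. var f \<le> \<Lambda> * (\<Sum>e\<in>I. c e * energy e f)" and L: "\<Lambda> \<ge> 1"
    and x: "x \<in> S" and wx: "exp (- B) \<le> w x" and f: "\<And>x. x \<in> S \<Longrightarrow> \<bar>f x\<bar> \<le> 1"
  shows "\<bar>(step ^^ t) f x - mean f\<bar> \<le> exp ((B - real t / (4 * \<Lambda>)) / 2)"
proof -
  let ?g = "(step ^^ t) f"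
  have "var f \<le> mean (\<lambda>x. (f x)\<^sup>2)" unfolding var_eq by simp
  also have "\<dots> \<le> mean (\<lambda>x. 1)" using f by (intro mean_mono) (simp add: abs_square_le_1)
  finally have v1: "var f \<le> 1" by (simp add: mean_const)
  have "exp (- B) * (?g x - mean f)\<^sup>2 \<le> w x * (?g x - mean f)\<^sup>2"
    by (intro mult_right_mono wx) auto
  also have "\<dots> \<le> (\<Sum>x\<in>S. w x * (?g x - mean f)\<^sup>2)"
    using finite_S x by (intro member_le_sum) (auto simp: w_pos less_imp_le)
  also have "\<dots> = var ?g" by (simp add: var_def mean_iter) (simp add: mean_def)
  also have "\<dots> \<le> (1 - 1 / (4 * \<Lambda>)) ^ t * var f" by (rule var_iter[OF poincare L])
  also have "\<dots> \<le> (1 - 1 / (4 * \<Lambda>)) ^ t" using v1 L by (intro mult_left_le) (auto simp: field_simps)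
  also have "\<dots> \<le> exp (- (1 / (4 * \<Lambda>))) ^ t"
    using L exp_ge_add_one_self[of "- (1 / (4 * \<Lambda>))"] by (intro power_mono) (auto simp: field_simps)
  also have "\<dots> = exp (- (real t / (4 * \<Lambda>)))" by (simp flip: exp_of_nat_mult)
  finally have "(?g x - mean f)\<^sup>2 \<le> exp B * exp (- (real t / (4 * \<Lambda>)))"
    by (simp add: exp_minus field_simps)
  also have "\<dots> = (exp ((B - real t / (4 * \<Lambda>)) / 2))\<^sup>2"
    by (simp add: power2_eq_square flip: exp_add) 
  finally show ?thesis by (meson abs_le_square_iff exp_ge_zero abs_of_nonneg power2_le_iff_abs_le)
qed

text \<open>The operator is a convex combination of values of \<open>f\<close>; the weight left at
  \<open>x\<close> is nonnegative because the rates sum to at most 3/4.\<close>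

lemma step_abs_le:
  assumes x: "x \<in> S" and f: "\<And>x. x \<in> S \<Longrightarrow> \<bar>f x\<bar> \<le> b"
  shows "\<bar>step f x\<bar> \<le> b"
proof -
  let ?p = "\<lambda>e. c e * acc e x"
  have "step f x = (1 - sum ?p I) * f x + (\<Sum>e\<in>I. ?p e * f (act e x))"
    by (simp add: step_def right_diff_distrib sum_subtractf left_diff_distrib sum_distrib_right)
  also have "\<bar>\<dots>\<bar> \<le> \<bar>(1 - sum ?p I) * f x\<bar> + (\<Sum>e\<in>I. \<bar>?p e * f (act e x)\<bar>)"
    by (rule order_trans[OF abs_triangle_ineq add_left_mono[OF sum_abs]])
  also have "\<dots> \<le> (1 - sum ?p I) * b + (\<Sum>e\<in>I. ?p e * b)"
    using sum_p_le[OF x] f x p_nonneg[OF x] act_in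
    by (intro add_mono sum_mono) (auto simp: abs_mult acc_bounds c_nonneg intro!: mult_left_mono mult_mono)
  also have "\<dots> = b" by (simp add: left_diff_distrib flip: sum_distrib_right)
  finally show ?thesis .
qed

lemma iter_abs_le:
  assumes f: "\<And>x. x \<in> S \<Longrightarrow> \<bar>f x\<bar> \<le> b"
  shows "x \<in> S \<Longrightarrow> \<bar>(step ^^ t) f x\<bar> \<le> b"
  by (induction t arbitrary: x) (auto simp: f intro!: step_abs_le)

lemma step_diff: "step f x - step g x = step (\<lambda>x. f x - g x) x"
  by (simp add: step_def right_diff_distrib sum_subtractf)

end

section \<open>Stability under small changes of the acceptance probabilities\<close>

locale metropolis_pair =
  p: metropolis_involutions S I act c w + q: metropolis_involutions S I act c w'
  for S :: "'s set" and I :: "'e set" and act c w w' +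
  fixes \<delta> :: real
  assumes acc_close: "e \<in> I \<Longrightarrow> x \<in> S \<Longrightarrow> \<bar>p.acc e x - q.acc e x\<bar> \<le> \<delta>"
    and \<delta>_nonneg: "0 \<le> \<delta>"
begin

lemma step_close:
  assumes x: "x \<in> S" and f: "\<And>x. x \<in> S \<Longrightarrow> \<bar>f x\<bar> \<le> 1"
  shows "\<bar>p.step f x - q.step f x\<bar> \<le> 2 * \<delta>"
proof -
  have "\<bar>p.step f x - q.step f x\<bar> = \<bar>\<Sum>e\<in>I. c e * (p.acc e x - q.acc e x) * (f (act e x) - f x)\<bar>"
    unfolding p.step_def q.step_def by (simp add: algebra_simps flip: sum_subtractf sum.distrib)
  also have "\<dots> \<le> (\<Sum>e\<in>I. c e * \<delta> * 2)"
  proof (rule order_trans[OF sum_abs], intro sum_mono)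
    fix e assume e: "e \<in> I"
    have "\<bar>f (act e x) - f x\<bar> \<le> 2" using f[OF x] f[OF p.act_in[OF e x]] by linarith
    thus "\<bar>c e * (p.acc e x - q.acc e x) * (f (act e x) - f x)\<bar> \<le> c e * \<delta> * 2"
      using acc_close[OF e x] p.c_nonneg[OF e] \<delta>_nonneg
      by (auto simp: abs_mult intro!: mult_mono)
  qed
  also have "\<dots> = sum c I * (2 * \<delta>)" by (simp add: mult.assoc flip: sum_distrib_right)
  also have "\<dots> \<le> 1 * (2 * \<delta>)" using p.sum_c \<delta>_nonneg by (intro mult_right_mono) auto
  finally show ?thesis by simp
qed

text \<open>The error of the last step is \<open>2 * \<delta>\<close> by \<open>step_close\<close>;
  the error inherited from earlier steps is not amplified, because \<open>q.step\<close> is linear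
  and contracts the supremum norm.\<close>

lemma iter_close:
  assumes f: "\<And>x. x \<in> S \<Longrightarrow> \<bar>f x\<bar> \<le> 1"
  shows "x \<in> S \<Longrightarrow> \<bar>(p.step ^^ t) f x - (q.step ^^ t) f x\<bar> \<le> 2 * \<delta> * t"
proof (induction t arbitrary: x)
  case (Suc t)
  let ?F = "(p.step ^^ t) f" and ?G = "(q.step ^^ t) f"
  have "\<bar>p.step ?F x - q.step ?F x\<bar> \<le> 2 * \<delta>"
    by (intro step_close Suc.prems p.iter_abs_le f)
  moreover have "\<bar>q.step (\<lambda>x. ?F x - ?G x) x\<bar> \<le> 2 * \<delta> * t"
    by (intro q.step_abs_le Suc)
  ultimately show ?case using q.step_diff[of ?F x ?G] by (simp add: algebra_simps)
qed auto

text \<open>The stationary mean of the first chain is invariant under its own steps, so closeness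
  of the two kernels transfers not only the marginal laws but also the stationary law.\<close>

lemma iter_converges:
  assumes conv: "\<And>x. x \<in> S \<Longrightarrow> \<bar>(q.step ^^ t) f x - q.mean f\<bar> \<le> \<eta>"
    and f: "\<And>x. x \<in> S \<Longrightarrow> \<bar>f x\<bar> \<le> 1" and x: "x \<in> S"
  shows "\<bar>(p.step ^^ t) f x - p.mean f\<bar> \<le> 4 * \<delta> * t + 2 * \<eta>"
proof -
  have near: "\<bar>(p.step ^^ t) f x - q.mean f\<bar> \<le> 2 * \<delta> * t + \<eta>" if "x \<in> S" for x
    using iter_close[where f = f and t = t, OF f that] conv[OF that] by linarith
  have "p.mean (\<lambda>x. (p.step ^^ t) f x - q.mean f) = p.mean f - q.mean f"
    by (simp add: p.mean_diff p.mean_const p.mean_iter)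
  with p.mean_abs_le[of "\<lambda>x. (p.step ^^ t) f x - q.mean f", OF near]
  have "\<bar>p.mean f - q.mean f\<bar> \<le> 2 * \<delta> * t + \<eta>" by simp
  with near[OF x] show ?thesis by linarith
qed

end

section \<open>Poincare inequality for replica exchange\<close>

locale replica_exchange =
  fixes \<Omega> :: "'a set" and \<mu> H :: "'a \<Rightarrow> real" and M :: nat
  assumes finite_\<Omega>: "finite \<Omega>" and \<Omega>_nonempty: "\<Omega> \<noteq> {}"
    and \<mu>_pos: "a \<in> \<Omega> \<Longrightarrow> 0 < \<mu> a"
begin

definition Z :: "nat \<Rightarrow> real" where
  "Z i = (\<Sum>a\<in>\<Omega>. exp (real i * H a) * \<mu> a)"

definition rho :: "nat \<Rightarrow> 'a \<Rightarrow> real" where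
  "rho i a = exp (real i * H a) * \<mu> a / Z i"

definition S :: "(nat \<Rightarrow> 'a) set" where
  "S = {0..M} \<rightarrow>\<^sub>E \<Omega>"

definition w :: "(nat \<Rightarrow> 'a) \<Rightarrow> real" where
  "w x = (\<Prod>i=0..M. rho i (x i))"

definition sw :: "nat \<Rightarrow> nat \<Rightarrow> (nat \<Rightarrow> 'a) \<Rightarrow> nat \<Rightarrow> 'a" where
  "sw i j x = x(i := x j, j := x i)"

lemma Z_pos: "0 < Z i"
  unfolding Z_def using finite_\<Omega> \<Omega>_nonempty \<mu>_pos by (intro sum_pos) auto

lemma rho_pos: "a \<in> \<Omega> \<Longrightarrow> 0 < rho i a"
  using Z_pos \<mu>_pos by (simp add: rho_def)

lemma sum_rho: "sum (rho i) \<Omega> = 1"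
  using Z_pos[of i] by (simp add: rho_def Z_def flip: sum_divide_distrib)

lemma finite_S: "finite S"
  unfolding S_def by (intro finite_PiE) (auto simp: finite_\<Omega>)

lemma S_in: "x \<in> S \<Longrightarrow> i \<le> M \<Longrightarrow> x i \<in> \<Omega>"
  by (auto simp: S_def)

lemma upd_in: "x \<in> S \<Longrightarrow> i \<le> M \<Longrightarrow> b \<in> \<Omega> \<Longrightarrow> x(i := b) \<in> S"
  by (auto simp: S_def PiE_def extensional_def)

lemma sw_in: "x \<in> S \<Longrightarrow> i \<le> M \<Longrightarrow> j \<le> M \<Longrightarrow> sw i j x \<in> S"
  unfolding sw_def by (intro upd_in S_in)

lemma sw_sw [simp]: "sw i j (sw i j x) = x"
  by (auto simp: sw_def)

lemma w_pos: "x \<in> S \<Longrightarrow> 0 < w x"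
  unfolding w_def by (intro prod_pos) (auto intro!: rho_pos S_in)

lemma sum_w: "sum w S = 1"
  unfolding w_def S_def
  by (subst prod_sum_PiE[symmetric]) (auto simp: finite_\<Omega> sum_rho)

text \<open>The product form avoids division and so holds for arbitrary \<open>x\<close> and
  \<open>b\<close>, without positivity.\<close>

lemma w_upd:
  assumes "i \<le> M"
  shows "w (x(i := b)) * rho i (x i) = w x * rho i b"
proof -
  have "w y = rho i (y i) * (\<Prod>k\<in>{0..M} - {i}. rho k (y k))" for y
    unfolding w_def using assms by (intro prod.remove) auto
  moreover have "(\<Prod>k\<in>{0..M} - {i}. rho k ((x(i := b)) k)) = (\<Prod>k\<in>{0..M} - {i}. rho k (x k))"
    by (intro prod.cong) auto
  ultimately show ?thesis by simp
qed

lemma w_sw_rho: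
  assumes "i < j" "j \<le> M"
  shows "w (sw i j x) * (rho i (x i) * rho j (x j)) = w x * (rho i (x j) * rho j (x i))"
  using w_upd[of j "x(i := x j)" "x i"] w_upd[of i x "x j"] assms
  by (simp add: sw_def) (metis mult.assoc mult.commute)

text \<open>\<open>Z\<close> and \<open>\<mu>\<close> occur on both sides and cancel; linearity of
  the exponent in the level leaves a product of two differences.\<close>

lemma rho_swap:
  "rho i a * rho j b = rho i b * rho j a * exp ((real j - real i) * (H b - H a))"
proof -
  have "exp (real i * H a) * exp (real j * H b) =
      exp (real i * H b) * exp (real j * H a) * exp ((real j - real i) * (H b - H a))"
    by (simp add: algebra_simps flip: exp_add)
  thus ?thesis by (simp add: rho_def field_simps)
qed

lemma w_sw:
  assumes "i < j" "j \<le> M" "x \<in> S"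
  shows "w (sw i j x) = w x * exp ((real j - real i) * (H (x i) - H (x j)))"
proof -
  have "rho i (x i) * rho j (x j) > 0"
    using assms by (intro mult_pos_pos rho_pos S_in) auto
  moreover have "w (sw i j x) * (rho i (x i) * rho j (x j)) =
      w x * exp ((real j - real i) * (H (x i) - H (x j))) * (rho i (x i) * rho j (x j))"
    using w_sw_rho[OF assms(1,2), of x] rho_swap[of i "x j" j "x i"] by simp
  ultimately show ?thesis by (metis mult_right_cancel order_less_irrefl)
qed

text \<open>Only the order of the two \<open>H\<close> values counts, not the distance of the
  levels: a swap gains weight when it carries the larger value to the higher level.\<close>

lemma w_le_w_sw_iff:
  assumes "i < j" "j \<le> M" "x \<in> S"
  shows "w x \<le> w (sw i j x) \<longleftrightarrow> H (x j) \<le> H (x i)"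
  using assms w_pos[of x] by (simp add: w_sw zero_le_mult_iff)

lemma sum_sw:
  assumes "i \<le> M" "j \<le> M"
  shows "(\<Sum>x\<in>S. h (sw i j x)) = (\<Sum>x\<in>S. h x)"
  by (rule sum.reindex_bij_witness[where i = "sw i j" and j = "sw i j"])
     (use assms in \<open>auto simp: sw_in\<close>)

text \<open>Trading coordinate \<open>i\<close> for the fresh value \<open>b\<close> is an
  involution of pairs.\<close>

lemma sum_exchange:
  assumes "i \<le> M"
  shows "(\<Sum>x\<in>S. \<Sum>b\<in>\<Omega>. h x b) = (\<Sum>x\<in>S. \<Sum>b\<in>\<Omega>. h (x(i := b)) (x i))"
  unfolding sum.cartesian_product
  by (rule sum.reindex_bij_witness[where i = "\<lambda>(x, b). (x(i := b), x i)" and j = "\<lambda>(x, b). (x(i := b), x i)"])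
     (use assms in \<open>auto simp: upd_in S_in\<close>)

lemma sum_resample:
  assumes "i \<le> M"
  shows "(\<Sum>x\<in>S. \<Sum>b\<in>\<Omega>. w x * rho i b * h (x(i := b))) = (\<Sum>x\<in>S. w x * h x)"
proof -
  have "(\<Sum>x\<in>S. \<Sum>b\<in>\<Omega>. w x * rho i b * h (x(i := b))) = (\<Sum>x\<in>S. \<Sum>b\<in>\<Omega>. w x * rho i b * h x)"
    by (subst sum_exchange[OF assms]) (simp add: w_upd[OF assms])
  also have "\<dots> = (\<Sum>x\<in>S. w x * h x * sum (rho i) \<Omega>)"
    by (simp add: sum_distrib_left mult_ac)
  finally show ?thesis by (simp add: sum_rho)
qed

lemma sum_marginal:
  assumes "i \<le> M"
  shows "(\<Sum>y\<in>S. w y * \<phi> (y i)) = (\<Sum>b\<in>\<Omega>. rho i b * \<phi> b)"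
proof -
  have "(\<Sum>y\<in>S. w y * \<phi> (y i)) = (\<Sum>y\<in>S. w y * (\<Sum>b\<in>\<Omega>. rho i b * \<phi> b))"
    using sum_resample[OF assms, of "\<lambda>y. \<phi> (y i)"] by (simp add: sum_distrib_left mult_ac)
  thus ?thesis by (simp add: sum_w flip: sum_distrib_right)
qed

text \<open>The Dirichlet form of drawing coordinate \<open>j\<close> afresh: twice the mean
  conditional variance of \<open>f\<close> given the other coordinates.\<close>

definition resample_energy :: "nat \<Rightarrow> ((nat \<Rightarrow> 'a) \<Rightarrow> real) \<Rightarrow> real" where
  "resample_energy j f = (\<Sum>x\<in>S. \<Sum>b\<in>\<Omega>. w x * rho j b * (f x - f (x(j := b)))\<^sup>2)"

definition swap_term :: "nat \<Rightarrow> nat \<Rightarrow> ((nat \<Rightarrow> 'a) \<Rightarrow> real) \<Rightarrow> (nat \<Rightarrow> 'a) \<Rightarrow> real" where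
  "swap_term i j f x = min (w x) (w (sw i j x)) * (f x - f (sw i j x))\<^sup>2"

definition swap_energy :: "nat \<Rightarrow> nat \<Rightarrow> ((nat \<Rightarrow> 'a) \<Rightarrow> real) \<Rightarrow> real" where
  "swap_energy i j f = (\<Sum>x\<in>S. swap_term i j f x)"

text \<open>A path from \<open>x\<close> at \<open>k = 0\<close> to \<open>y\<close> at
  \<open>k = M + 1\<close> that replaces one coordinate at a time.\<close>

definition splice :: "nat \<Rightarrow> (nat \<Rightarrow> 'a) \<Rightarrow> (nat \<Rightarrow> 'a) \<Rightarrow> nat \<Rightarrow> 'a" where
  "splice k x y = (\<lambda>i. if i < k then y i else x i)"

lemma splice_in: "x \<in> S \<Longrightarrow> y \<in> S \<Longrightarrow> splice k x y \<in> S"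
  by (auto simp: S_def splice_def PiE_iff extensional_def)

text \<open>For independent \<open>x\<close> and \<open>y\<close> distributed as \<open>w\<close>, the spliced pair
  \<open>(splice k x y, splice k y x)\<close> has the same joint law as \<open>(x, y)\<close>.\<close>

lemma splice_energy:
  assumes "k \<le> M"
  shows "(\<Sum>x\<in>S. \<Sum>y\<in>S. w x * w y * (f (splice k x y) - f (splice (Suc k) x y))\<^sup>2) = resample_energy k f"
proof -
  have ww: "w (splice k x y) * w (splice k y x) = w x * w y" for x y
    unfolding w_def prod.distrib[symmetric] by (rule prod.cong) (auto simp: splice_def)
  have sp: "splice (Suc k) x y = (splice k x y)(k := splice k y x k)" for x y
    by (auto simp: splice_def)
  have inv: "splice k (splice k x y) (splice k y x) = x" for x y
    by (auto simp: splice_def)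
  have "(\<Sum>x\<in>S. \<Sum>y\<in>S. w x * w y * (f (splice k x y) - f (splice (Suc k) x y))\<^sup>2) 
     = (\<Sum>x\<in>S. \<Sum>y\<in>S. w x * w y * (f x - f (x(k := y k)))\<^sup>2)"
    unfolding sum.cartesian_product
    by (rule sum.reindex_bij_witness[where i = "\<lambda>(x, y). (splice k x y, splice k y x)"
          and j = "\<lambda>(x, y). (splice k x y, splice k y x)"])
       (auto simp: splice_in inv ww sp)
  also have "\<dots> = (\<Sum>x\<in>S. w x * (\<Sum>y\<in>S. w y * (f x - f (x(k := y k)))\<^sup>2))"
    by (simp add: sum_distrib_left mult_ac)
  also have "\<dots> = resample_energy k f"
    by (simp add: sum_marginal[OF assms, of "\<lambda>b. (f _ - f (_(k := b)))\<^sup>2"] resample_energy_def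
        sum_distrib_left mult_ac)
  finally show ?thesis .
qed

text \<open>A crude Efron-Stein inequality: telescope along the spliced path and apply
  Cauchy-Schwarz, which costs the factor \<open>M + 1\<close>.\<close>

lemma tensorization:
  "(\<Sum>x\<in>S. \<Sum>y\<in>S. w x * w y * (f x - f y)\<^sup>2) \<le> real (M + 1) * (\<Sum>k\<le>M. resample_energy k f)"
proof -
  have "(\<Sum>x\<in>S. \<Sum>y\<in>S. w x * w y * (f x - f y)\<^sup>2) 
    \<le> (\<Sum>x\<in>S. \<Sum>y\<in>S. w x * w y * (real (M + 1) * (\<Sum>k<M+1. (f (splice k x y) - f (splice (Suc k) x y))\<^sup>2)))"
  proof (intro sum_mono mult_left_mono)
    fix x y assume xy: "x \<in> S" "y \<in> S"
    have "splice 0 x y = x" by (auto simp: splice_def)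
    moreover have "splice (M + 1) x y = y"
      using xy by (auto simp: splice_def S_def PiE_def extensional_def)
    ultimately have "f x - f y = (\<Sum>k<M+1. f (splice k x y) - f (splice (Suc k) x y))"
      by (subst sum_lessThan_telescope') simp
    thus "(f x - f y)\<^sup>2 \<le> real (M + 1) * (\<Sum>k<M+1. (f (splice k x y) - f (splice (Suc k) x y))\<^sup>2)"
      using Cauchy_Schwarz_ineq_sum[of "\<lambda>_. 1" "\<lambda>k. f (splice k x y) - f (splice (Suc k) x y)" "{..<M+1}"]
      by simp
    show "0 \<le> w x * w y" using xy by (simp add: w_pos less_imp_le)
  qed
  also have "\<dots> = real (M + 1) * (\<Sum>k<M+1. 
     \<Sum>x\<in>S. \<Sum>y\<in>S. w x * w y * (f (splice k x y) - f (splice (Suc k) x y))\<^sup>2)"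
  proof -
    have "(\<Sum>k\<in>K. \<Sum>x\<in>S. \<Sum>y\<in>S. h k x y) = (\<Sum>x\<in>S. \<Sum>y\<in>S. \<Sum>k\<in>K. h k x y)"
      for K :: "nat set" and h :: "nat \<Rightarrow> (nat \<Rightarrow> 'a) \<Rightarrow> (nat \<Rightarrow> 'a) \<Rightarrow> real"
      by (subst sum.swap) (rule sum.cong[OF refl sum.swap])
    thus ?thesis by (simp only: sum_distrib_left mult_ac)
  qed
  also have "\<dots> = real (M + 1) * (\<Sum>k<M+1. resample_energy k f)"
    by (simp add: splice_energy)
  finally show ?thesis by (simp add: lessThan_Suc_atMost)
qed

lemma three_squares: 
  fixes a b c d :: real 
  shows "(a - d)\<^sup>2 \<le> 3 * ((a - b)\<^sup>2 + (b - c)\<^sup>2 + (c - d)\<^sup>2)"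
proof -
  have "3 * ((a - b)\<^sup>2 + (b - c)\<^sup>2 + (c - d)\<^sup>2) - (a - d)\<^sup>2 =
     ((a - b) - (b - c))\<^sup>2 + ((a - b) - (c - d))\<^sup>2 + ((b - c) - (c - d))\<^sup>2"
    by (simp add: power2_eq_square algebra_simps)
  thus ?thesis by (smt (verit) zero_le_power2)
qed

text \<open>Resampling coordinate \<open>j\<close> is routed through coordinate \<open>0\<close>: write the new value
  there, swap it to \<open>j\<close>, and restore coordinate \<open>0\<close>.\<close>

lemma resample_energy_le:
  assumes j: "0 < j" "j \<le> M" and A: "\<And>b. b \<in> \<Omega> \<Longrightarrow> rho j b \<le> A * rho 0 b"
  shows "resample_energy j f \<le> 3 * A * (2 * resample_energy 0 f + swap_energy 0 j f)"
proof -
  define T1 where "T1 = (\<Sum>x\<in>S. \<Sum>b\<in>\<Omega>. w x * rho j b * (f x - f (x(0 := b)))\<^sup>2)"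
  define T2 where "T2 = (\<Sum>x\<in>S. \<Sum>b\<in>\<Omega>. w x * rho j b * (f (x(0 := b)) - f (sw 0 j (x(0 := b))))\<^sup>2)"
  define T3 where "T3 = (\<Sum>x\<in>S. \<Sum>b\<in>\<Omega>. w x * rho j b * (f (x(0 := x j, j := b)) - f (x(j := b)))\<^sup>2)"
  obtain a where a: "a \<in> \<Omega>" using \<Omega>_nonempty by auto
  have "0 < A * rho 0 a" using A[OF a] rho_pos[OF a, of j] by linarith
  hence A0: "0 < A" using rho_pos[OF a, of 0] by (simp add: zero_less_mult_iff)
  have "resample_energy j f \<le> (\<Sum>x\<in>S. \<Sum>b\<in>\<Omega>. w x * rho j b * (3 * ((f x - f (x(0 := b)))\<^sup>2 + 
     (f (x(0 := b)) - f (sw 0 j (x(0 := b))))\<^sup>2 + (f (x(0 := x j, j := b)) - f (x(j := b)))\<^sup>2)))"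
    unfolding resample_energy_def
  proof (intro sum_mono mult_left_mono)
    fix x b assume xb: "x \<in> S" "b \<in> \<Omega>"
    have "sw 0 j (x(0 := b)) = x(0 := x j, j := b)" using j by (auto simp: sw_def)
    thus "(f x - f (x(j := b)))\<^sup>2 \<le> 3 * ((f x - f (x(0 := b)))\<^sup>2 + 
     (f (x(0 := b)) - f (sw 0 j (x(0 := b))))\<^sup>2 + (f (x(0 := x j, j := b)) - f (x(j := b)))\<^sup>2)"
      using three_squares by simp
    show "0 \<le> w x * rho j b" using xb by (simp add: w_pos rho_pos less_imp_le)
  qed
  also have "\<dots> = 3 * (T1 + T2 + T3)"
    unfolding T1_def T2_def T3_def
    by (simp add: sum_distrib_left sum.distrib algebra_simps)
  finally have 0: "resample_energy j f \<le> 3 * (T1 + T2 + T3)" .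
  have 1: "T1 \<le> A * resample_energy 0 f"
  proof -
    have "T1 \<le> (\<Sum>x\<in>S. \<Sum>b\<in>\<Omega>. w x * (A * rho 0 b) * (f x - f (x(0 := b)))\<^sup>2)"
      unfolding T1_def by (intro sum_mono mult_right_mono mult_left_mono A) (auto simp: w_pos less_imp_le)
    thus ?thesis by (simp add: resample_energy_def sum_distrib_left mult_ac)
  qed
  \<comment> \<open>Exchanging \<open>b\<close> with coordinate \<open>j\<close> turns restoring
    coordinate 0 into the writing step, read backwards.\<close>
  have 3: "T3 = T1"
  proof -
    have "T3 = (\<Sum>x\<in>S. \<Sum>b\<in>\<Omega>. w (x(j := b)) * rho j (x j) * (f (x(0 := b)) - f x)\<^sup>2)"
    proof -
      have e: "x(0 := b, j := x j) = x(0 := b)" for x :: "nat \<Rightarrow> 'a" and b using j by auto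
      show ?thesis
        unfolding T3_def by (subst sum_exchange[OF j(2)]) (simp add: e)
    qed
    thus ?thesis unfolding T1_def using w_upd[OF j(2)] by (simp add: power2_commute)
  qed
  \<comment> \<open>The flux through a swap must be bounded by the weights of both its ends. The
    domination by \<open>rho 0\<close> is applied at \<open>x 0\<close> for the end
    \<open>x\<close>, and at \<open>x j\<close> for the swapped end.\<close>
  have 2: "T2 \<le> A * swap_energy 0 j f"
  proof -
    have "T2 = (\<Sum>x\<in>S. \<Sum>b\<in>\<Omega>. w (x(0 := b)) * rho j (x 0) * (f x - f (sw 0 j x))\<^sup>2)"
      unfolding T2_def by (subst sum_exchange[of 0]) auto
    also have "\<dots> \<le> (\<Sum>x\<in>S. \<Sum>b\<in>\<Omega>. A * rho 0 b * swap_term 0 j f x)"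
    proof (intro sum_mono)
      fix x b assume xb: "x \<in> S" "b \<in> \<Omega>"
      have r: "rho 0 (x 0) > 0" "rho j (x j) > 0" "rho j (x 0) > 0" "rho 0 b > 0" "w x > 0"
        using xb j by (auto intro!: rho_pos S_in w_pos)
      have e: "w (x(0 := b)) = w x * rho 0 b / rho 0 (x 0)"
        using w_upd[of 0 x b] r by (simp add: field_simps)
      have s: "w (sw 0 j x) = w x * (rho 0 (x j) * rho j (x 0)) / (rho 0 (x 0) * rho j (x j))"
        using w_sw_rho[OF j, of x] r by (simp add: field_simps)
      have "rho j (x 0) / rho 0 (x 0) \<le> A"
        using A[OF S_in[OF xb(1), of 0]] r by (simp add: field_simps)
      hence "w x * rho 0 b * (rho j (x 0) / rho 0 (x 0)) \<le> w x * rho 0 b * A"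
        using r by (intro mult_left_mono) auto
      hence "w (x(0 := b)) * rho j (x 0) \<le> A * rho 0 b * w x"
        unfolding e by (simp add: field_simps)
      moreover have "w (x(0 := b)) * rho j (x 0) \<le> A * rho 0 b * w (sw 0 j x)"
      proof -
        have "1 \<le> A * rho 0 (x j) / rho j (x j)"
          using A[OF S_in[OF xb(1) j(2)]] r by (simp add: field_simps)
        hence "w x * rho 0 b * rho j (x 0) / rho 0 (x 0) * 1 
           \<le> w x * rho 0 b * rho j (x 0) / rho 0 (x 0) * (A * rho 0 (x j) / rho j (x j))"
          using r by (intro mult_left_mono) auto
        thus ?thesis unfolding e s by (simp add: mult_ac)
      qed
      ultimately have "w (x(0 := b)) * rho j (x 0) \<le> A * rho 0 b * min (w x) (w (sw 0 j x))"
        by (auto simp: min_def)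
      from mult_right_mono[OF this, of "(f x - f (sw 0 j x))\<^sup>2"]
      show "w (x(0 := b)) * rho j (x 0) * (f x - f (sw 0 j x))\<^sup>2 \<le> A * rho 0 b * swap_term 0 j f x"
        by (simp add: swap_term_def mult_ac)
    qed
    also have "\<dots> = A * swap_energy 0 j f * sum (rho 0) \<Omega>"
      by (simp add: swap_energy_def sum_distrib_left sum_distrib_right mult_ac)
    finally show ?thesis by (simp add: sum_rho)
  qed
  show ?thesis using 0 1 2 3 by (simp add: algebra_simps)
qed

section \<open>Long-range swaps from adjacent ones\<close>

lemma swap_term_nonneg: "x \<in> S \<Longrightarrow> i \<le> M \<Longrightarrow> j \<le> M \<Longrightarrow> 0 \<le> swap_term i j f x"
  by (simp add: swap_term_def w_pos sw_in less_imp_le)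

lemma swap_energy_nonneg: "i \<le> M \<Longrightarrow> j \<le> M \<Longrightarrow> 0 \<le> swap_energy i j f"
  unfolding swap_energy_def by (intro sum_nonneg) (rule swap_term_nonneg)

lemma swap_term_sw: "swap_term i j f (sw i j x) = swap_term i j f x"
  by (simp add: swap_term_def power2_commute min.commute)

lemma le_swap_term:
  assumes "u \<le> w x" "u \<le> w (sw i j x)"
  shows "u * (f x - f (sw i j x))\<^sup>2 \<le> swap_term i j f x"
  unfolding swap_term_def using assms by (intro mult_right_mono) auto

text \<open>A transposition of \<open>i\<close> and \<open>j\<close> factors through \<open>m\<close> in two ways. For each state one of
  them passes only through states of weight at least that of the lighter end point.\<close>

lemma swap_energy_midpoint:
  assumes "i < m" "m < j" "j \<le> M"
  shows "swap_energy i j f \<le> 18 * (swap_energy i m f + swap_energy m j f)"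
proof -
  define r1 where "r1 x = swap_term m j f x + swap_term i m f (sw m j x) 
     + swap_term m j f (sw i m (sw m j x))" for x
  define r2 where "r2 x = swap_term i m f x + swap_term m j f (sw i m x)
     + swap_term i m f (sw m j (sw i m x))" for x
  define r where "r x = 3 * (r1 x + r2 x)" for x
  have le: "i \<le> M" "m \<le> M" "j \<le> M" using assms by auto
  note in_S = sw_in[OF _ le(1,2)] sw_in[OF _ le(2,3)] sw_in[OF _ le(1,3)]
  have r1_nonneg: "0 \<le> r1 x" and r2_nonneg: "0 \<le> r2 x" if "x \<in> S" for x
    unfolding r1_def r2_def using that le by (auto intro!: add_nonneg_nonneg swap_term_nonneg in_S)
  have fac1: "sw i j x = sw m j (sw i m (sw m j x))" 
   and fac2: "sw i j x = sw i m (sw m j (sw i m x))" for x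
    using assms by (auto simp: sw_def)
  have main: "swap_term i j f x \<le> r x" if x: "x \<in> S" and wle: "w x \<le> w (sw i j x)" for x
  proof -
    have H: "H (x j) \<le> H (x i)" using wle w_le_w_sw_iff[of i j x] assms x by auto
    have t: "swap_term i j f x = w x * (f x - f (sw i j x))\<^sup>2"
      using wle by (simp add: swap_term_def)
    have path: "swap_term i j f x \<le> 
       3 * (w x * (f x - f y)\<^sup>2 + w x * (f y - f z)\<^sup>2 + w x * (f z - f (sw i j x))\<^sup>2)" for y z
      unfolding t using mult_left_mono[OF three_squares[of "f x" "f (sw i j x)" "f y" "f z"], of "w x"]
        w_pos[OF x] by (simp add: algebra_simps)
    show ?thesis
    \<comment> \<open>With \<open>x\<close> the lighter end, the position of \<open>H (x m)\<close>
      decides which factorization begins with a swap that loses no weight. Its second swap then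
      loses none either, and the third joins states already known to weigh at least
      \<open>w x\<close>.\<close>
    proof (cases "H (x j) \<le> H (x m)")
      case True
      define y where "y = sw m j x"
      define z where "z = sw i m y"
      have S: "y \<in> S" "z \<in> S" by (auto simp: y_def z_def intro!: in_S x)
      have fin: "sw i j x = sw m j z" by (simp add: fac1 y_def z_def)
      have "w x \<le> w y" unfolding y_def using True assms x by (subst w_le_w_sw_iff) auto
      moreover have "w y \<le> w z" unfolding z_def using H S assms 
        by (subst w_le_w_sw_iff) (auto simp: y_def sw_def)
      ultimately have "w x * (f x - f y)\<^sup>2 \<le> swap_term m j f x" 
        "w x * (f y - f z)\<^sup>2 \<le> swap_term i m f y" "w x * (f z - f (sw i j x))\<^sup>2 \<le> swap_term m j f z"
        using wle unfolding fin by (auto simp: y_def z_def intro!: le_swap_term)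
      hence "swap_term i j f x \<le> 3 * r1 x" using path[of y z] unfolding r1_def y_def z_def by argo
      thus ?thesis using r2_nonneg[OF x] by (simp add: r_def)
    next
      case False
      define y where "y = sw i m x"
      define z where "z = sw m j y"
      have S: "y \<in> S" "z \<in> S" by (auto simp: y_def z_def intro!: in_S x)
      have fin: "sw i j x = sw i m z" by (simp add: fac2 y_def z_def)
      have "w x \<le> w y" unfolding y_def using False H assms x by (subst w_le_w_sw_iff) auto
      moreover have "w y \<le> w z" unfolding z_def using H S assms 
        by (subst w_le_w_sw_iff) (auto simp: y_def sw_def)
      ultimately have "w x * (f x - f y)\<^sup>2 \<le> swap_term i m f x" 
        "w x * (f y - f z)\<^sup>2 \<le> swap_term m j f y" "w x * (f z - f (sw i j x))\<^sup>2 \<le> swap_term i m f z"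
        using wle unfolding fin by (auto simp: y_def z_def intro!: le_swap_term)
      hence "swap_term i j f x \<le> 3 * r2 x" using path[of y z] unfolding r2_def y_def z_def by argo
      thus ?thesis using r1_nonneg[OF x] by (simp add: r_def)
    qed
  qed
  \<comment> \<open>\<open>main\<close> applies to the lighter end only, so the bounds at both ends
    are added. The constant 18 is 2 for the two ends, 3 from \<open>three_squares\<close>, and 3
    because each energy occurs three times in \<open>r1\<close> and \<open>r2\<close>
    together.\<close>
  have "swap_energy i j f \<le> (\<Sum>x\<in>S. r x + r (sw i j x))"
    unfolding swap_energy_def
  proof (intro sum_mono)
    fix x assume x: "x \<in> S"
    have r0: "0 \<le> r x" "0 \<le> r (sw i j x)" 
      using r1_nonneg r2_nonneg x in_S by (auto simp: r_def)
    show "swap_term i j f x \<le> r x + r (sw i j x)"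
      using main[OF x] main[OF in_S(3)[OF x]] r0 by (cases "w x \<le> w (sw i j x)") (auto simp: swap_term_sw)
  qed
  also have "\<dots> = 2 * (\<Sum>x\<in>S. r x)"
    using sum_sw[OF le(1,3), of r] by (simp add: sum.distrib)
  also have "(\<Sum>x\<in>S. r x) = 9 * (swap_energy i m f + swap_energy m j f)"
    using sum_sw[OF le(2,3), of "\<lambda>x. swap_term m j f (sw i m x)"] sum_sw[OF le(1,2), of "swap_term m j f"]
      sum_sw[OF le(2,3), of "swap_term i m f"] 
      sum_sw[OF le(1,2), of "\<lambda>x. swap_term i m f (sw m j x)"] sum_sw[OF le(1,2), of "swap_term i m f"]
    by (simp add: r_def r1_def r2_def swap_energy_def sum.distrib algebra_simps flip: sum_distrib_left)
  finally show ?thesis by simp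
qed

text \<open>Halving the distance pays 18 once per doubling; peeling off one level at a time would
  make the constant exponential in the distance.\<close>

lemma swap_energy_le_adjacent:
  assumes "i < j" "j \<le> M" "j - i \<le> 2 ^ k"
  shows "swap_energy i j f \<le> 18 ^ k * (\<Sum>l=i..<j. swap_energy l (Suc l) f)"
  using assms
proof (induction k arbitrary: i j)
  case 0
  hence "j = Suc i" by auto
  thus ?case by simp
next
  case (Suc k)
  have nonneg: "0 \<le> (\<Sum>l=a..<b. swap_energy l (Suc l) f)" if "b \<le> M" for a b
    using that by (intro sum_nonneg swap_energy_nonneg) auto
  show ?case
  proof (cases "j = Suc i")
    case True
    thus ?thesis using nonneg[OF Suc.prems(2), of i] 
      mult_right_mono[of 1 "18 ^ Suc k" "\<Sum>l=i..<j. swap_energy l (Suc l) f"] one_le_power[of "18::real" "Suc k"]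
      by simp
  next
    case False
    define m where "m = (i + j) div 2"
    have m: "i < m" "m < j" "m - i \<le> 2 ^ k" "j - m \<le> 2 ^ k" using Suc.prems False by (auto simp: m_def)
    have "swap_energy i j f \<le> 18 * (swap_energy i m f + swap_energy m j f)"
      using m Suc.prems by (intro swap_energy_midpoint)
    also have "\<dots> \<le> 18 * (18 ^ k * (\<Sum>l=i..<m. swap_energy l (Suc l) f) + 18 ^ k * (\<Sum>l=m..<j. swap_energy l (Suc l) f))"
      using m Suc.prems by (intro mult_left_mono add_mono Suc.IH) auto
    also have "\<dots> = 18 ^ Suc k * ((\<Sum>l=i..<m. swap_energy l (Suc l) f) + (\<Sum>l=m..<j. swap_energy l (Suc l) f))"
      by (simp add: algebra_simps)
    also have "(\<Sum>l=i..<m. swap_energy l (Suc l) f) + (\<Sum>l=m..<j. swap_energy l (Suc l) f) = (\<Sum>l=i..<j. swap_energy l (Suc l) f)"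
      using m by (intro sum.atLeastLessThan_concat) auto
    finally show ?thesis .
  qed
qed

text \<open>With \<open>2 ^ k\<close> at most twice \<open>j\<close>, the constant is polynomial:
  \<open>18 ^ k \<le> 32 ^ k = (2 ^ k) ^ 5\<close>.\<close>

lemma swap_energy_0_le:
  assumes "0 < j" "j \<le> M"
  shows "swap_energy 0 j f \<le> (2 * real M) ^ 5 * (\<Sum>l<M. swap_energy l (Suc l) f)"
proof -
  have "\<exists>k. j \<le> 2 ^ k \<and> 2 ^ k \<le> 2 * j" using \<open>0 < j\<close>
  proof (induction j rule: nat_induct_non_zero)
    case (Suc j)
    then obtain k where k: "j \<le> 2 ^ k" "2 ^ k \<le> 2 * j" by blast
    show ?case
      by (cases "Suc j \<le> 2 ^ k", rule exI[of _ k], use k in simp, rule exI[of _ "Suc k"], use k zero_less_power[of "2::nat" k] in \<open>simp, linarith?\<close>)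
  qed (auto intro: exI[of _ 0])
  then obtain k where k: "j \<le> 2 ^ k" "2 ^ k \<le> 2 * j" by blast
  have "(18::real) ^ k \<le> 32 ^ k" by (intro power_mono) auto
  also have "\<dots> = (2 ^ k) ^ 5" by (simp flip: power_mult power_mult_distrib add: mult.commute[of k 5]) (simp add: power_mult)
  also have "\<dots> \<le> (2 * real M) ^ 5"
  proof (intro power_mono)
    have "real (2 ^ k) \<le> real (2 * j)" using k by (simp only: of_nat_le_iff)
    thus "(2::real) ^ k \<le> 2 * real M" using assms by simp
  qed auto
  finally have "(18::real) ^ k \<le> (2 * real M) ^ 5" .
  moreover have "(\<Sum>l=0..<j. swap_energy l (Suc l) f) \<le> (\<Sum>l<M. swap_energy l (Suc l) f)"
    using assms by (intro sum_mono2) (auto intro!: swap_energy_nonneg)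
  moreover have "0 \<le> (\<Sum>l=0..<j. swap_energy l (Suc l) f)"
    using assms by (intro sum_nonneg swap_energy_nonneg) auto
  ultimately have "18 ^ k * (\<Sum>l=0..<j. swap_energy l (Suc l) f) \<le> (2 * real M) ^ 5 * (\<Sum>l<M. swap_energy l (Suc l) f)"
    by (intro mult_mono) simp_all
  moreover have "swap_energy 0 j f \<le> 18 ^ k * (\<Sum>l=0..<j. swap_energy l (Suc l) f)"
    using assms k by (intro swap_energy_le_adjacent) simp_all
  ultimately show ?thesis by (rule order_trans[rotated])
qed

lemma resample_energy_nonneg: "j \<le> M \<Longrightarrow> 0 \<le> resample_energy j f"
  unfolding resample_energy_def 
  by (intro sum_nonneg mult_nonneg_nonneg) (auto simp: w_pos rho_pos less_imp_le)

lemma poincare: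
  assumes A: "\<And>j b. j \<le> M \<Longrightarrow> b \<in> \<Omega> \<Longrightarrow> rho j b \<le> A * rho 0 b" and "1 \<le> A"
  shows "(\<Sum>x\<in>S. \<Sum>y\<in>S. w x * w y * (f x - f y)\<^sup>2) \<le>
    6 * real (M + 1) ^ 2 * A * (resample_energy 0 f + (2 * real M) ^ 5 * (\<Sum>l<M. swap_energy l (Suc l) f))"
proof -
  define E where "E = resample_energy 0 f + (2 * real M) ^ 5 * (\<Sum>l<M. swap_energy l (Suc l) f)"
  have sw0: "0 \<le> (\<Sum>l<M. swap_energy l (Suc l) f)" by (intro sum_nonneg swap_energy_nonneg) auto
  have r0: "0 \<le> resample_energy 0 f" by (rule resample_energy_nonneg) simp
  have E: "resample_energy 0 f \<le> E" using sw0 by (simp add: E_def)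
  have "resample_energy k f \<le> 6 * A * E" if "k \<le> M" for k
  proof (cases "k = 0")
    case True
    have "1 * resample_energy 0 f \<le> (6 * A) * E" using E r0 \<open>1 \<le> A\<close> by (intro mult_mono) auto
    thus ?thesis using True by simp
  next
    case False
    have "resample_energy k f \<le> 3 * A * (2 * resample_energy 0 f + swap_energy 0 k f)"
      using False that A by (intro resample_energy_le) auto
    also have "\<dots> \<le> 3 * A * (2 * E)"
    proof (intro mult_left_mono)
      define X where "X = (2 * real M) ^ 5 * (\<Sum>l<M. swap_energy l (Suc l) f)"
      have "0 \<le> X"
        unfolding X_def using sw0 by (intro mult_nonneg_nonneg) auto
      moreover have "swap_energy 0 k f \<le> X"
        unfolding X_def using False that by (intro swap_energy_0_le) simp_all
      ultimately show "2 * resample_energy 0 f + swap_energy 0 k f \<le> 2 * E"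
        unfolding E_def X_def[symmetric] by (simp add: distrib_left)
    qed (use \<open>1 \<le> A\<close> in auto)
    finally show ?thesis by simp
  qed
  hence "(\<Sum>k\<le>M. resample_energy k f) \<le> (\<Sum>k\<le>M. 6 * A * E)" by (intro sum_mono) auto
  hence "real (M + 1) * (\<Sum>k\<le>M. resample_energy k f) \<le> real (M + 1) * (real (M + 1) * (6 * A * E))"
    by (intro mult_left_mono) auto
  also have "real (M + 1) * (real (M + 1) * (6 * A * E)) = 6 * real (M + 1) ^ 2 * A * E"
    by (simp only: power2_eq_square mult_ac)
  finally show ?thesis using tensorization[of f] unfolding E_def[symmetric] by (rule order_trans[rotated])
qed

end

section \<open>Poincare inequality on the cube\<close>

lemma finite_configs: "finite (configs n)"
  unfolding configs_def by (intro finite_PiE) auto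

definition flip :: "nat \<Rightarrow> (nat \<Rightarrow> int) \<Rightarrow> nat \<Rightarrow> int" where
  "flip v x = x(v := - x v)"

lemma configs_cases: "x \<in> configs n \<Longrightarrow> v \<in> {1..n} \<Longrightarrow> x v = 1 \<or> x v = - 1"
  by (auto simp: configs_def)

lemma flip_in: "x \<in> configs n \<Longrightarrow> v \<in> {1..n} \<Longrightarrow> flip v x \<in> configs n"
  unfolding flip_def using configs_cases[of x n v]
  by (auto simp: configs_def PiE_iff extensional_def)

lemma flip_flip [simp]: "flip v (flip v x) = x"
  by (simp add: flip_def)

lemma num_plus_le: "num_plus n x \<le> n"
proof -
  have "card {v \<in> {1..n}. x v = 1} \<le> card {1..n}" by (intro card_mono) auto
  thus ?thesis by (simp add: num_plus_def)
qed

lemma num_plus_flip_up: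
  assumes "v \<in> {1..n}" "x v = - 1"
  shows "num_plus n (flip v x) = Suc (num_plus n x)"
proof -
  have "{u \<in> {1..n}. flip v x u = 1} = insert v {u \<in> {1..n}. x u = 1}"
    using assms by (auto simp: flip_def)
  thus ?thesis using assms by (simp add: num_plus_def)
qed

lemma num_plus_flip_down:
  assumes "v \<in> {1..n}" "x v = 1"
  shows "Suc (num_plus n (flip v x)) = num_plus n x"
proof -
  have "flip v x v = - 1" using assms by (simp add: flip_def)
  from num_plus_flip_up[of v n "flip v x", OF assms(1) this] show ?thesis by simp
qed

definition layer :: "nat \<Rightarrow> nat \<Rightarrow> (nat \<Rightarrow> int) set" where
  "layer n k = {x \<in> configs n. num_plus n x = k}"

lemma finite_layer: "finite (layer n k)"
  by (simp add: layer_def finite_configs)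

lemma card_layer: "card (layer n k) = n choose k"
proof -
  have "bij_betw (\<lambda>x. {v \<in> {1..n}. x v = 1}) (layer n k) {A. A \<subseteq> {1..n} \<and> card A = k}"
  proof (rule bij_betw_byWitness[where f' = "\<lambda>A v. if v \<in> A then 1 else if v \<in> {1..n} then - 1 else undefined"])
    show "\<forall>x\<in>layer n k. (\<lambda>v. if v \<in> {v \<in> {1..n}. x v = 1} then 1 else if v \<in> {1..n} then - 1 else undefined) = x"
      by (auto simp: layer_def fun_eq_iff dest: configs_cases) (auto simp: configs_def PiE_iff extensional_def)
    show "\<forall>A\<in>{A. A \<subseteq> {1..n} \<and> card A = k}. {v \<in> {1..n}. (if v \<in> A then 1 else if v \<in> {1..n} then - 1 else undefined) = (1::int)} = A"
      by (auto split: if_splits)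
    show "(\<lambda>x. {v \<in> {1..n}. x v = 1}) ` layer n k \<subseteq> {A. A \<subseteq> {1..n} \<and> card A = k}"
      by (auto simp: layer_def num_plus_def)
    have "num_plus n (\<lambda>v. if v \<in> A then 1 else if v \<in> {1..n} then - 1 else undefined) = card A" 
      if "A \<subseteq> {1..n}" for A
      unfolding num_plus_def by (rule arg_cong[where f = card]) (use that in \<open>auto split: if_splits\<close>)
    thus "(\<lambda>A v. if v \<in> A then 1 else if v \<in> {1..n} then - 1 else undefined) ` {A. A \<subseteq> {1..n} \<and> card A = k} \<subseteq> layer n k"
      by (auto simp: layer_def configs_def PiE_iff extensional_def split: if_splits)
  qed
  from bij_betw_same_card[OF this] show ?thesis by (simp add: n_subsets)
qed

lemma sum_configs_layers: "(\<Sum>x\<in>configs n. h x) = (\<Sum>k\<le>n. \<Sum>x\<in>layer n k. h x)"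
  unfolding layer_def
  by (rule sum.group[symmetric]) (auto simp: finite_configs num_plus_le)

text \<open>Level 0 without its normalization: every layer has total weight 1.\<close>

definition base_weight :: "nat \<Rightarrow> (nat \<Rightarrow> int) \<Rightarrow> real" where
  "base_weight n x = 1 / real (n choose num_plus n x)"

lemma base_weight_pos: "0 < base_weight n x"
  using num_plus_le[of n x] by (simp add: base_weight_def)

lemma sum_layer_base_weight: "k \<le> n \<Longrightarrow> (\<Sum>x\<in>layer n k. base_weight n x) = 1"
proof -
  assume k: "k \<le> n"
  have "(\<Sum>x\<in>layer n k. base_weight n x) = (\<Sum>x\<in>layer n k. 1 / real (n choose k))"
    by (rule sum.cong) (auto simp: base_weight_def layer_def)
  thus ?thesis using k by (simp add: card_layer)
qed

lemma sum_base_weight: "(\<Sum>x\<in>configs n. base_weight n x) = real n + 1"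
  by (simp add: sum_configs_layers sum_layer_base_weight)

definition layer_sum :: "nat \<Rightarrow> ((nat \<Rightarrow> int) \<Rightarrow> real) \<Rightarrow> nat \<Rightarrow> real" where
  "layer_sum n \<phi> k = (\<Sum>x\<in>layer n k. base_weight n x * (\<phi> x)\<^sup>2)"

definition up :: "nat \<Rightarrow> (nat \<Rightarrow> int) \<Rightarrow> nat set" where
  "up n x = {v \<in> {1..n}. x v = - 1}"

text \<open>The part of the Dirichlet form carried by the edges between layers \<open>k\<close> and
  \<open>k + 1\<close>, each met once, from below.\<close>

definition edge_sum :: "nat \<Rightarrow> ((nat \<Rightarrow> int) \<Rightarrow> real) \<Rightarrow> nat \<Rightarrow> real" where
  "edge_sum n \<phi> k = (\<Sum>x\<in>layer n k. \<Sum>v\<in>up n x. 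
     min (base_weight n x) (base_weight n (flip v x)) * (\<phi> x - \<phi> (flip v x))\<^sup>2)"

lemma card_up: "x \<in> configs n \<Longrightarrow> card (up n x) = n - num_plus n x"
proof -
  assume x: "x \<in> configs n"
  have "up n x = {1..n} - {v \<in> {1..n}. x v = 1}" unfolding up_def
    using configs_cases[OF x] by fastforce
  moreover have "card ({1..n} - {v \<in> {1..n}. x v = 1}) = card {1..n} - card {v \<in> {1..n}. x v = 1}"
    by (intro card_Diff_subset) auto
  ultimately show ?thesis by (simp add: num_plus_def)
qed

text \<open>Double counting of the edges between two neighbouring layers.\<close>

lemma sum_up_down:
  "(\<Sum>y\<in>layer n (Suc k). \<Sum>v\<in>{v \<in> {1..n}. y v = 1}. h y v) = (\<Sum>x\<in>layer n k. \<Sum>v\<in>up n x. h (flip v x) v)"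
proof -
  have A: "flip v x \<in> layer n (Suc k) \<and> flip v x v = 1" if "x \<in> layer n k" "v \<in> {1..n}" "x v = - 1" for x v
    using that num_plus_flip_up[of v n x] flip_in[of x n v] by (auto simp: layer_def) (simp add: flip_def)
  have B: "flip v y \<in> layer n k \<and> flip v y v = - 1" if "y \<in> layer n (Suc k)" "v \<in> {1..n}" "y v = 1" for y v
    using that num_plus_flip_down[of v n y] flip_in[of y n v] by (auto simp: layer_def) (simp add: flip_def)
  have "(\<Sum>(y, v)\<in>Sigma (layer n (Suc k)) (\<lambda>y. {v \<in> {1..n}. y v = 1}). h y v)
      = (\<Sum>(x, v)\<in>Sigma (layer n k) (up n). h (flip v x) v)"
    by (rule sum.reindex_bij_witness[where i = "\<lambda>(x, v). (flip v x, v)" and j = "\<lambda>(x, v). (flip v x, v)"])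
       (auto simp: up_def A B)
  thus ?thesis by (subst (1 2) sum.Sigma) (auto simp: finite_layer up_def)
qed

lemma young_square:
  fixes a b t :: real assumes "t > 0"
  shows "(a + b)\<^sup>2 \<le> (1 + 1 / t) * a\<^sup>2 + (1 + t) * b\<^sup>2"
proof -
  have "(1 + 1 / t) * a\<^sup>2 + (1 + t) * b\<^sup>2 - (a + b)\<^sup>2 = (a - t * b)\<^sup>2 / t"
    using assms by (simp add: power2_eq_square field_simps)
  moreover have "(a - t * b)\<^sup>2 / t \<ge> 0" using assms by simp
  ultimately show ?thesis by linarith
qed

text \<open>A coupling of neighbouring layers: splitting the mass of a configuration evenly over its
  upward edges gives each edge the mass that it receives from its upper end over the downward
  edges.\<close>

lemma base_weight_split:
  assumes "x \<in> configs n" "v \<in> up n x"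
  defines "k \<equiv> num_plus n x"
  shows "base_weight n (flip v x) / real (Suc k) = base_weight n x / real (n - k)"
proof -
  have v: "v \<in> {1..n}" "x v = - 1" using assms by (auto simp: up_def)
  have k: "num_plus n (flip v x) = Suc k" using num_plus_flip_up[of v n x, OF v] by (simp add: k_def)
  hence kn: "Suc k \<le> n" using num_plus_le[of n "flip v x"] by simp
  have "Suc k * (n choose Suc k) = (n choose k) * (n - k)"
    by (metis binomial_absorb_comp binomial_absorption mult.commute diff_Suc_1 Suc_times_binomial_add)
  hence "real (Suc k) * real (n choose Suc k) = real (n choose k) * real (n - k)"
    by (simp only: of_nat_mult[symmetric])
  thus ?thesis using kn k by (simp add: base_weight_def k_def[symmetric] field_simps del: of_nat_Suc of_nat_diff)
qed

text \<open>The second moment is transported along that coupling. \<open>young_square\<close> is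
  used with \<open>t = n\<close>, so that the growth factor \<open>1 + 1 / n\<close> stays bounded
  when compounded over all \<open>n\<close> layers.\<close>

lemma layer_sum_Suc:
  assumes "Suc k \<le> n"
  shows "layer_sum n \<phi> (Suc k) \<le> (1 + 1 / real n) * layer_sum n \<phi> k + (1 + real n) * edge_sum n \<phi> k"
proof -
  have n0: "real n > 0" using assms by simp
  have "layer_sum n \<phi> (Suc k) = 
     (\<Sum>y\<in>layer n (Suc k). \<Sum>v\<in>{v \<in> {1..n}. y v = 1}. base_weight n y / real (Suc k) * (\<phi> y)\<^sup>2)"
    unfolding layer_sum_def by (rule sum.cong) (auto simp: layer_def num_plus_def simp del: of_nat_Suc)
  also have "\<dots> = (\<Sum>x\<in>layer n k. \<Sum>v\<in>up n x. base_weight n (flip v x) / real (Suc k) * (\<phi> (flip v x))\<^sup>2)"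
    by (rule sum_up_down)
  also have "\<dots> \<le> (\<Sum>x\<in>layer n k. \<Sum>v\<in>up n x. (1 + 1 / real n) * (base_weight n x / real (n - k) * (\<phi> x)\<^sup>2)
       + (1 + real n) * (min (base_weight n x) (base_weight n (flip v x)) * (\<phi> x - \<phi> (flip v x))\<^sup>2))"
  proof (intro sum_mono)
    fix x v assume x: "x \<in> layer n k" and v: "v \<in> up n x"
    have k: "num_plus n x = k" "x \<in> configs n" using x by (auto simp: layer_def)
    define b where "b = base_weight n x / real (n - k)"
    have b: "base_weight n (flip v x) / real (Suc k) = b"
      using base_weight_split[OF k(2) v] by (simp add: k b_def)
    have b0: "b \<ge> 0" using base_weight_pos[of n x] by (simp add: b_def)
    have "base_weight n x * 1 \<le> base_weight n x * real (n - k)"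
      using assms base_weight_pos[of n x] by (intro mult_left_mono) auto
    hence "b \<le> base_weight n x" using assms by (simp add: b_def divide_le_eq del: of_nat_diff)
    moreover have "b \<le> base_weight n (flip v x)" 
      using base_weight_pos[of n "flip v x"] by (simp add: b[symmetric] field_simps)
    ultimately have bm: "b \<le> min (base_weight n x) (base_weight n (flip v x))" by simp
    have "(\<phi> (flip v x))\<^sup>2 \<le> (1 + 1 / real n) * (\<phi> x)\<^sup>2 + (1 + real n) * (\<phi> x - \<phi> (flip v x))\<^sup>2"
      using young_square[OF n0, of "\<phi> x" "\<phi> (flip v x) - \<phi> x"] by (simp add: power2_commute)
    from mult_left_mono[OF this b0]
    have "b * (\<phi> (flip v x))\<^sup>2 \<le> (1 + 1 / real n) * (b * (\<phi> x)\<^sup>2) + (1 + real n) * (b * (\<phi> x - \<phi> (flip v x))\<^sup>2)"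
      by (simp add: algebra_simps)
    also have "\<dots> \<le> (1 + 1 / real n) * (b * (\<phi> x)\<^sup>2) + (1 + real n) * (min (base_weight n x) (base_weight n (flip v x)) * (\<phi> x - \<phi> (flip v x))\<^sup>2)"
      using bm by (intro add_left_mono mult_left_mono mult_right_mono) auto
    finally show "base_weight n (flip v x) / real (Suc k) * (\<phi> (flip v x))\<^sup>2 \<le> 
      (1 + 1 / real n) * (base_weight n x / real (n - k) * (\<phi> x)\<^sup>2)
       + (1 + real n) * (min (base_weight n x) (base_weight n (flip v x)) * (\<phi> x - \<phi> (flip v x))\<^sup>2)"
      unfolding b b_def .
  qed
  also have "\<dots> = (1 + 1 / real n) * (\<Sum>x\<in>layer n k. \<Sum>v\<in>up n x. base_weight n x / real (n - k) * (\<phi> x)\<^sup>2)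
       + (1 + real n) * edge_sum n \<phi> k"
    unfolding edge_sum_def by (simp only: sum.distrib sum_distrib_left)
  also have "(\<Sum>x\<in>layer n k. \<Sum>v\<in>up n x. base_weight n x / real (n - k) * (\<phi> x)\<^sup>2) = layer_sum n \<phi> k"
    unfolding layer_sum_def using assms
    by (intro sum.cong) (auto simp: layer_def card_up)
  finally show ?thesis .
qed

lemma edge_sum_nonneg: "0 \<le> edge_sum n \<phi> k"
  unfolding edge_sum_def by (intro sum_nonneg mult_nonneg_nonneg) (auto simp: base_weight_pos less_imp_le)

text \<open>Layer 0 is the single all-minus configuration, so the recursion starts at 0; its
  compounded factor is at most \<open>exp 1\<close>, hence at most 3.\<close>

lemma layer_sum_le:
  assumes "k \<le> n" "\<phi> (\<lambda>v\<in>{1..n}. - 1) = 0"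
  shows "layer_sum n \<phi> k \<le> 3 * (1 + real n) * (\<Sum>j<n. edge_sum n \<phi> j)"
proof -
  define r where "r = 1 + 1 / real n"
  have r1: "r \<ge> 1" by (simp add: r_def)
  have "layer_sum n \<phi> k \<le> r ^ k * ((1 + real n) * (\<Sum>j<k. edge_sum n \<phi> j))" using \<open>k \<le> n\<close>
  proof (induction k)
    case 0
    have "x = (\<lambda>v\<in>{1..n}. - 1)" if "x \<in> layer n 0" for x
    proof
      fix v show "x v = (\<lambda>v\<in>{1..n}. - 1) v"
      proof (cases "v \<in> {1..n}")
        case True
        have "{v \<in> {1..n}. x v = 1} = {}" using that by (simp add: layer_def num_plus_def)
        with True have "x v \<noteq> 1" by blast
        thus ?thesis using configs_cases[of x n v] that True by (auto simp: layer_def)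
      qed (use that in \<open>auto simp: layer_def configs_def PiE_iff extensional_def\<close>)
    qed
    with assms(2) have "layer_sum n \<phi> 0 = 0" unfolding layer_sum_def by (intro sum.neutral) auto
    thus ?case by simp
  next
    case (Suc k)
    have "layer_sum n \<phi> (Suc k) \<le> r * layer_sum n \<phi> k + 1 * ((1 + real n) * edge_sum n \<phi> k)"
      using layer_sum_Suc[OF Suc.prems] by (simp add: r_def)
    also have "\<dots> \<le> r * (r ^ k * ((1 + real n) * (\<Sum>j<k. edge_sum n \<phi> j))) + r ^ Suc k * ((1 + real n) * edge_sum n \<phi> k)"
      using Suc r1 by (intro add_mono mult_left_mono mult_right_mono one_le_power) (auto simp: edge_sum_nonneg)
    finally show ?case by (simp add: algebra_simps)
  qed
  also have "\<dots> \<le> 3 * ((1 + real n) * (\<Sum>j<n. edge_sum n \<phi> j))"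
  proof (intro mult_mono sum_mono2)
    have "r ^ k \<le> r ^ n" using r1 assms by (intro power_increasing)
    also have "\<dots> \<le> exp 1" 
      using exp_ge_one_plus_x_over_n_power_n[of n 1] assms by (cases "n = 0") (auto simp: r_def)
    also have "\<dots> \<le> 3" by (rule exp_le)
    finally show "r ^ k \<le> 3" .
  qed (use assms in \<open>auto simp: edge_sum_nonneg intro!: sum_nonneg mult_nonneg_nonneg\<close>)
  finally show ?thesis by (simp only: mult.assoc)
qed

text \<open>The walk on layers is started from the all-minus configuration; both end points of a pair
  are compared with it.\<close>

lemma cube_poincare:
  "(\<Sum>a\<in>configs n. \<Sum>b\<in>configs n. base_weight n a * base_weight n b * (\<phi> a - \<phi> b)\<^sup>2) \<le>
    12 * (real n + 1) ^ 3 * (\<Sum>x\<in>configs n. \<Sum>v\<in>{1..n}. 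
      min (base_weight n x) (base_weight n (flip v x)) * (\<phi> x - \<phi> (flip v x))\<^sup>2)"
proof -
  define c where "c = \<phi> (\<lambda>v\<in>{1..n}. - 1)"
  define \<psi> where "\<psi> x = \<phi> x - c" for x
  define E where "E = (\<Sum>x\<in>configs n. \<Sum>v\<in>{1..n}. 
      min (base_weight n x) (base_weight n (flip v x)) * (\<phi> x - \<phi> (flip v x))\<^sup>2)"
  define W where "W = (\<Sum>x\<in>configs n. base_weight n x * (\<psi> x)\<^sup>2)"
  have "edge_sum n \<psi> k \<le> (\<Sum>x\<in>layer n k. \<Sum>v\<in>{1..n}. 
      min (base_weight n x) (base_weight n (flip v x)) * (\<phi> x - \<phi> (flip v x))\<^sup>2)" for k
    unfolding edge_sum_def \<psi>_def
    by (intro sum_mono) (auto intro!: sum_mono2 simp: up_def base_weight_pos less_imp_le)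
  hence "(\<Sum>k\<le>n. edge_sum n \<psi> k) \<le> E"
    unfolding E_def sum_configs_layers by (intro sum_mono)
  moreover have "(\<Sum>k<n. edge_sum n \<psi> k) \<le> (\<Sum>k\<le>n. edge_sum n \<psi> k)"
    by (intro sum_mono2) (auto simp: edge_sum_nonneg)
  ultimately have E: "(\<Sum>k<n. edge_sum n \<psi> k) \<le> E" by simp
  have "W = (\<Sum>k\<le>n. layer_sum n \<psi> k)"
    unfolding W_def sum_configs_layers layer_sum_def ..
  also have "\<dots> \<le> (\<Sum>k\<le>n. 3 * (1 + real n) * E)"
    using E by (intro sum_mono order_trans[OF layer_sum_le] mult_left_mono) (auto simp: \<psi>_def c_def)
  finally have W: "W \<le> (real n + 1) * (3 * (1 + real n) * E)" by (simp add: add.commute)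
  have "(\<Sum>a\<in>configs n. \<Sum>b\<in>configs n. base_weight n a * base_weight n b * (\<phi> a - \<phi> b)\<^sup>2) 
    \<le> (\<Sum>a\<in>configs n. \<Sum>b\<in>configs n. base_weight n a * base_weight n b * (2 * (\<psi> a)\<^sup>2 + 2 * (\<psi> b)\<^sup>2))"
  proof (intro sum_mono mult_left_mono)
    fix a b
    have "2 * (\<psi> a)\<^sup>2 + 2 * (\<psi> b)\<^sup>2 - (\<phi> a - \<phi> b)\<^sup>2 = (\<psi> a + \<psi> b)\<^sup>2"
      by (simp add: \<psi>_def power2_eq_square algebra_simps)
    thus "(\<phi> a - \<phi> b)\<^sup>2 \<le> 2 * (\<psi> a)\<^sup>2 + 2 * (\<psi> b)\<^sup>2" by (smt (verit) zero_le_power2)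
  qed (auto simp: base_weight_pos less_imp_le)
  also have "\<dots> = (\<Sum>a\<in>configs n. 2 * (base_weight n a * (\<psi> a)\<^sup>2) * (real n + 1) + base_weight n a * (2 * W))"
    unfolding W_def sum_base_weight[symmetric]
    by (simp only: sum_distrib_left sum.distrib[symmetric]) (simp add: algebra_simps)
  also have "\<dots> = 4 * (real n + 1) * W"
    unfolding sum.distrib by (simp add: sum_base_weight W_def[symmetric] flip: sum_distrib_left sum_distrib_right)
  also have "\<dots> \<le> 4 * (real n + 1) * ((real n + 1) * (3 * (1 + real n) * E))"
    using W by (intro mult_left_mono) auto
  also have "\<dots> = 12 * (real n + 1) ^ 3 * E"
    by (simp add: power3_eq_cube algebra_simps)
  finally show ?thesis unfolding E_def .
qed

section \<open>The flat-swap chain for a general layer potential\<close>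

text \<open>Consecutive binomials have ratio \<open>(n - k) / (k + 1)\<close>, which lies between
  \<open>1 / n\<close> and \<open>n\<close>.\<close>

lemma base_weight_ratio:
  assumes "n > 0" "x \<in> configs n" "v \<in> {1..n}"
  shows "base_weight n (flip v x) \<le> real n * base_weight n x"
proof -
  have up_ratio: "base_weight n (flip v y) \<le> real n * base_weight n y \<and> base_weight n y \<le> real n * base_weight n (flip v y)"
    if y: "y \<in> configs n" "y v = - 1" for y
  proof -
    define k where "k = num_plus n y"
    have k: "Suc k \<le> n" using num_plus_flip_up[of v n y, OF assms(3) y(2)] num_plus_le[of n "flip v y"] by (simp add: k_def)
    have "v \<in> up n y" using assms y by (simp add: up_def)
    from base_weight_split[OF y(1) this] k
    have e: "base_weight n (flip v y) * real (n - k) = base_weight n y * real (Suc k)"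
      by (simp add: k_def[symmetric] field_simps del: of_nat_Suc of_nat_diff)
    have p: "0 < base_weight n y" "0 < base_weight n (flip v y)" by (rule base_weight_pos)+
    have "base_weight n (flip v y) * 1 \<le> base_weight n (flip v y) * real (n - k)"
      using k p by (intro mult_left_mono) auto
    also have "\<dots> \<le> base_weight n y * real n"
      unfolding e using k p by (intro mult_left_mono) auto
    finally have 1: "base_weight n (flip v y) \<le> real n * base_weight n y" by (simp add: mult.commute)
    have "base_weight n y * 1 \<le> base_weight n y * real (Suc k)"
      using k p by (intro mult_left_mono) auto
    also have "\<dots> \<le> base_weight n (flip v y) * real n"
      unfolding e[symmetric] using k p by (intro mult_left_mono) auto
    finally show ?thesis using 1 by (simp add: mult.commute)
  qed
  show ?thesis
  proof (cases "x v = - 1")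
    case False
    hence "flip v x v = - 1" using configs_cases[OF assms(2,3)] by (auto simp: flip_def)
    with up_ratio[of "flip v x"] flip_in[OF assms(2,3)] show ?thesis by simp
  qed (use up_ratio assms in blast)
qed

text \<open>\<open>G\<close> is left arbitrary because two instances are compared later: the true
  potential and the one with compressed gaps.\<close>

locale flat_swap_model =
  fixes n M :: nat and G :: "nat \<Rightarrow> real"
  assumes n_pos: "0 < n" and M_pos: "0 < M"
begin

sublocale replica_exchange "configs n" "base_weight n" "\<lambda>a. G (num_plus n a) / real M" M
proof
  show "configs n \<noteq> {}" by (simp add: configs_def PiE_eq_empty_iff)
qed (auto simp: finite_configs base_weight_pos)

definition moves :: "(nat \<times> nat + nat) set" where
  "moves = ({0..M} \<times> {1..n}) <+> {0..<M}"

fun act :: "nat \<times> nat + nat \<Rightarrow> (nat \<Rightarrow> nat \<Rightarrow> int) \<Rightarrow> nat \<Rightarrow> nat \<Rightarrow> int" where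
  "act (Inl (i, v)) x = x(i := flip v (x i))"
| "act (Inr i) x = sw i (Suc i) x"

text \<open>A flip has 1/2 for a level move, then \<open>1 / (M + 1)\<close> and
  \<open>1 / n\<close> for level and vertex, and 1/2 for drawing the spin that differs from the
  present one. The totals are 1/4 for flips and 1/2 for swaps.\<close>

fun rate :: "nat \<times> nat + nat \<Rightarrow> real" where
  "rate (Inl _) = 1 / (4 * (real M + 1) * real n)"
| "rate (Inr _) = 1 / (2 * real M)"

lemma sum_moves: "(\<Sum>e\<in>moves. h e) = (\<Sum>i=0..M. \<Sum>v\<in>{1..n}. h (Inl (i, v))) + (\<Sum>i<M. h (Inr i))"
  unfolding moves_def by (subst sum.Plus) (auto simp: sum.cartesian_product atLeast0LessThan)

sublocale chain: metropolis_involutions S moves act rate w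
proof
  fix e x assume e: "e \<in> moves" and x: "x \<in> S"
  show "act e x \<in> S"
  proof (cases e)
    case (Inl p)
    then obtain i v where p: "e = Inl (i, v)" "i \<le> M" "v \<in> {1..n}"
      using e by (cases p) (auto simp: moves_def)
    show ?thesis unfolding p(1) act.simps by (rule upd_in[OF x p(2) flip_in[OF S_in[OF x p(2)] p(3)]])
  next
    case (Inr i)
    thus ?thesis using e x by (auto simp: moves_def intro!: sw_in)
  qed
  show "act e (act e x) = x"
    using e x by (cases e) (auto simp: moves_def)
next
  show "sum rate moves \<le> 3 / 4"
  proof -
    have e: "(real M + 1) * (real n * (1 / (4 * (real M + 1) * real n))) = 1 / 4"
      using n_pos by (simp only: divide_simps) (simp add: add_pos_nonneg add_eq_0_iff)
    have "sum rate moves = (real M + 1) * (real n * (1 / (4 * (real M + 1) * real n))) + 1 / 2"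
      unfolding sum_moves rate.simps sum_constant using M_pos by (simp add: field_simps)
    thus ?thesis unfolding e by simp
  qed
  show "0 \<le> rate e" if "e \<in> moves" for e
    using that by (cases e) auto
qed (auto simp: finite_S w_pos sum_w moves_def)

lemma Z_0: "Z 0 = real n + 1"
  by (simp add: Z_def sum_base_weight)

lemma rho_0: "rho 0 a = base_weight n a / (real n + 1)"
  by (simp add: rho_def Z_0)

text \<open>The layer of \<open>a\<close> alone contributes this much, because its base weights sum
  to 1.\<close>

lemma exp_le_Z:
  assumes "a \<in> configs n"
  shows "exp (real j * (G (num_plus n a) / real M)) \<le> Z j"
proof -
  let ?L = "layer n (num_plus n a)"
  have "exp (real j * (G (num_plus n a) / real M)) = exp (real j * (G (num_plus n a) / real M)) * (\<Sum>b\<in>?L. base_weight n b)"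
    by (simp add: sum_layer_base_weight num_plus_le)
  also have "\<dots> = (\<Sum>b\<in>?L. exp (real j * (G (num_plus n b) / real M)) * base_weight n b)"
    unfolding sum_distrib_left by (rule sum.cong) (auto simp: layer_def)
  also have "\<dots> \<le> Z j"
    unfolding Z_def by (rule sum_mono2) (auto simp: finite_configs layer_def base_weight_pos less_imp_le)
  finally show ?thesis .
qed

text \<open>Here dampening pays off: the constant \<open>A\<close> of \<open>poincare\<close> may be
  taken as \<open>n + 1\<close>, whatever \<open>G\<close> is.\<close>

lemma rho_le_rho_0:
  assumes "a \<in> configs n"
  shows "rho j a \<le> (real n + 1) * rho 0 a"
proof -
  have "exp (real j * (G (num_plus n a) / real M)) / Z j \<le> 1"
    using exp_le_Z[OF assms, of j] Z_pos[of j] by simp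
  from mult_right_mono[OF this, of "base_weight n a"] show ?thesis
    using base_weight_pos[of n a] by (simp add: rho_def[of j] rho_0)
qed

lemma energy_swap: "chain.energy (Inr l) f = swap_energy l (Suc l) f"
  by (simp add: chain.energy_def swap_energy_def swap_term_def)

text \<open>\<open>cube_poincare\<close> in coordinate 0 with the others frozen. Passing to
  \<open>rho 0\<close> divides the left side by \<open>(n + 1) ^ 2\<close> and the energy by
  \<open>n + 1\<close>, which lowers the exponent from 3 to 2.\<close>

lemma resample_energy_0_le:
  "resample_energy 0 f \<le> 12 * (real n + 1) ^ 2 * (\<Sum>v\<in>{1..n}. chain.energy (Inl (0, v)) f)"
proof -
  define ratio where "ratio a v = min 1 (rho 0 (flip v a) / rho 0 a)" for a v
  have rp: "rho 0 a > 0" for a using base_weight_pos[of n a] by (simp add: rho_0 add_pos_nonneg)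
  have base: "base_weight n a = (real n + 1) * rho 0 a" for a by (simp add: rho_0 add_pos_nonneg)
  have min_rho: "min (base_weight n a) (base_weight n (flip v a)) = (real n + 1) * (rho 0 a * ratio a v)" for a v
  proof -
    have "rho 0 a * ratio a v = min (rho 0 a) (rho 0 (flip v a))"
      using rp[of a] unfolding ratio_def by (auto simp: min_def field_simps)
    moreover have "min (c * p) (c * q) = c * min p q" if "0 < c" for c p q :: real
      using that by (auto simp: min_def)
    ultimately show ?thesis using base[of a] base[of "flip v a"] by (simp add: add_pos_nonneg)
  qed
  have one: "(\<Sum>a\<in>configs n. rho 0 a * (\<Sum>b\<in>configs n. rho 0 b * (\<phi> a - \<phi> b)\<^sup>2)) \<le>
    12 * (real n + 1)\<^sup>2 * (\<Sum>a\<in>configs n. rho 0 a * (\<Sum>v\<in>{1..n}. ratio a v * (\<phi> a - \<phi> (flip v a))\<^sup>2))" for \<phi>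
  proof -
    define D where "D = (\<Sum>a\<in>configs n. rho 0 a * (\<Sum>b\<in>configs n. rho 0 b * (\<phi> a - \<phi> b)\<^sup>2))"
    define E where "E = (\<Sum>a\<in>configs n. rho 0 a * (\<Sum>v\<in>{1..n}. ratio a v * (\<phi> a - \<phi> (flip v a))\<^sup>2))"
    have "(\<Sum>a\<in>configs n. \<Sum>b\<in>configs n. base_weight n a * base_weight n b * (\<phi> a - \<phi> b)\<^sup>2) = (real n + 1)\<^sup>2 * D"
    proof -
      have "base_weight n a * base_weight n b * t = (real n + 1)\<^sup>2 * (rho 0 a * (rho 0 b * t))" for a b t
        by (simp add: rho_0 power2_eq_square add_pos_nonneg)
      thus ?thesis unfolding D_def sum_distrib_left by (intro sum.cong refl)
    qed
    moreover have "(\<Sum>a\<in>configs n. \<Sum>v\<in>{1..n}. min (base_weight n a) (base_weight n (flip v a)) * (\<phi> a - \<phi> (flip v a))\<^sup>2)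
      = (real n + 1) * E"
      unfolding E_def sum_distrib_left by (intro sum.cong refl) (simp only: min_rho mult.assoc)
    ultimately have "(real n + 1)\<^sup>2 * D \<le> 12 * (real n + 1) ^ 3 * ((real n + 1) * E)"
      using cube_poincare[of n \<phi>] by (simp only:)
    also have "\<dots> = (real n + 1)\<^sup>2 * (12 * (real n + 1)\<^sup>2 * E)"
      by (simp only: power2_eq_square power3_eq_cube mult_ac)
    finally show ?thesis unfolding D_def[symmetric] E_def[symmetric]
      by (rule mult_left_le_imp_le) simp
  qed
  define h where "h x = (\<Sum>b\<in>configs n. rho 0 b * (f x - f (x(0 := b)))\<^sup>2)" for x
  define g where "g x = (\<Sum>v\<in>{1..n}. ratio (x 0) v * (f x - f (x(0 := flip v (x 0))))\<^sup>2)" for x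
  have "resample_energy 0 f = (\<Sum>x\<in>S. w x * h x)"
    unfolding resample_energy_def h_def by (simp only: sum_distrib_left mult_ac)
  also have "\<dots> = (\<Sum>x\<in>S. \<Sum>a\<in>configs n. w x * rho 0 a * h (x(0 := a)))"
    by (rule sum_resample[symmetric]) simp
  also have "\<dots> = (\<Sum>x\<in>S. w x * (\<Sum>a\<in>configs n. rho 0 a * h (x(0 := a))))"
    by (simp only: sum_distrib_left mult_ac)
  also have "\<dots> \<le> (\<Sum>x\<in>S. w x * (12 * (real n + 1)\<^sup>2 * (\<Sum>a\<in>configs n. rho 0 a * g (x(0 := a)))))"
    using one[of "\<lambda>a. f (_(0 := a))"]
    by (intro sum_mono mult_left_mono) (auto simp: h_def g_def w_pos less_imp_le)
  also have "\<dots> = 12 * (real n + 1)\<^sup>2 * (\<Sum>x\<in>S. \<Sum>a\<in>configs n. w x * rho 0 a * g (x(0 := a)))"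
    by (simp only: sum_distrib_left mult_ac)
  also have "(\<Sum>x\<in>S. \<Sum>a\<in>configs n. w x * rho 0 a * g (x(0 := a))) = (\<Sum>x\<in>S. w x * g x)"
    by (rule sum_resample) simp
  also have "\<dots> = (\<Sum>x\<in>S. \<Sum>v\<in>{1..n}. min (w x) (w (x(0 := flip v (x 0)))) * (f x - f (x(0 := flip v (x 0))))\<^sup>2)"
  proof -
    have "w x * ratio (x 0) v = min (w x) (w (x(0 := flip v (x 0))))" if "x \<in> S" for x v
    proof -
      have e: "w (x(0 := flip v (x 0))) = w x * (rho 0 (flip v (x 0)) / rho 0 (x 0))"
        using w_upd[of 0 x "flip v (x 0)"] rp[of "x 0"] by (simp add: field_simps)
      have "p * min 1 r = min p (p * r)" if "0 < p" for p r :: real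
        using that by (auto simp: min_def)
      thus ?thesis unfolding e ratio_def using w_pos[OF \<open>x \<in> S\<close>] by blast
    qed
    thus ?thesis unfolding g_def by (simp add: sum_distrib_left flip: mult.assoc)
  qed
  also have "\<dots> = (\<Sum>v\<in>{1..n}. chain.energy (Inl (0, v)) f)"
    by (subst sum.swap) (simp add: chain.energy_def)
  finally show ?thesis .
qed

text \<open>The product of \<open>3 * (M + 1) ^ 2 * (n + 1)\<close> from \<open>poincare\<close>,
  the inverse flip rate \<open>4 * (M + 1) * n\<close>, and the larger cost of the two kinds of
  energy. It does not involve \<open>G\<close>, so both instances share it.\<close>

definition relax :: real where
  "relax = 12 * (real M + 1) ^ 3 * (real n * (real n + 1)) * (12 * (real n + 1) ^ 2 + 32 * real M ^ 5)"

lemma relax_ge_1: "1 \<le> relax"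
proof -
  have "1 * 1 * 1 * 1 \<le> 12 * (real M + 1) ^ 3 * (real n * (real n + 1)) * (12 * (real n + 1) ^ 2 + 32 * real M ^ 5)"
  proof (intro mult_mono)
    show "1 \<le> (real M + 1) ^ 3" by (rule one_le_power) simp
    show "1 \<le> real n * (real n + 1)" using n_pos by (simp add: mult_ge1_I)
    have "1 \<le> (real n + 1) ^ 2" by (rule one_le_power) simp
    moreover have "0 \<le> real M ^ 5" by simp
    ultimately show "1 \<le> 12 * (real n + 1) ^ 2 + 32 * real M ^ 5" by linarith
  qed auto
  thus ?thesis by (simp add: relax_def)
qed

lemma chain_poincare: "chain.var f \<le> relax * (\<Sum>e\<in>moves. rate e * chain.energy e f)"
proof -
  define c where "c = 1 / (4 * (real M + 1) * real n)"
  define F where "F = (\<Sum>v\<in>{1..n}. chain.energy (Inl (0, v)) f)"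
  define V where "V = (\<Sum>l<M. swap_energy l (Suc l) f)"
  define T where "T = (\<Sum>e\<in>moves. rate e * chain.energy e f)"
  define K where "K = 12 * (real n + 1) ^ 2 + 32 * real M ^ 5"
  have c0: "c > 0" using n_pos by (simp add: c_def add_pos_nonneg)
  have en: "0 \<le> chain.energy e f" if "e \<in> moves" for e
    unfolding chain.energy_def by (intro sum_nonneg mult_nonneg_nonneg)
      (auto simp: w_pos less_imp_le chain.act_in that)
  have F0: "0 \<le> F" unfolding F_def by (intro sum_nonneg en) (auto simp: moves_def)
  have V0: "0 \<le> V" unfolding V_def by (intro sum_nonneg swap_energy_nonneg) auto
  \<comment> \<open>Of the flips, only those at level 0 are kept; the other energies are
    nonnegative.\<close>
  have "c * F \<le> (\<Sum>i=0..M. \<Sum>v\<in>{1..n}. rate (Inl (i, v)) * chain.energy (Inl (i, v)) f)"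
  proof -
    have "c * F = (\<Sum>i\<in>{0}. \<Sum>v\<in>{1..n}. rate (Inl (i, v)) * chain.energy (Inl (i, v)) f)"
      by (simp add: F_def c_def sum_distrib_left)
    also have "\<dots> \<le> (\<Sum>i=0..M. \<Sum>v\<in>{1..n}. rate (Inl (i, v)) * chain.energy (Inl (i, v)) f)"
      by (intro sum_mono2 sum_nonneg mult_nonneg_nonneg en) (auto simp: moves_def)
    finally show ?thesis .
  qed
  moreover have "c * V \<le> (\<Sum>i<M. rate (Inr i) * chain.energy (Inr i) f)"
  proof -
    have "1 * 2 * real M \<le> real n * 4 * (real M + 1)" using n_pos M_pos by (intro mult_mono) auto
    hence "c \<le> 1 / (2 * real M)" using n_pos M_pos by (simp add: c_def field_simps)
    thus ?thesis unfolding V_def sum_distrib_left energy_swap rate.simps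
      by (intro sum_mono mult_right_mono swap_energy_nonneg) auto
  qed
  ultimately have T: "c * (F + V) \<le> T" unfolding T_def sum_moves by (simp add: distrib_left)
  have "2 * chain.var f \<le> 6 * real (M + 1) ^ 2 * (real n + 1) * (resample_energy 0 f + (2 * real M) ^ 5 * V)"
    unfolding chain.var_eq_double_sum V_def by (rule poincare) (auto intro: rho_le_rho_0)
  also have "\<dots> \<le> 6 * real (M + 1) ^ 2 * (real n + 1) * (K * (F + V))"
  proof (intro mult_left_mono)
    have "12 * (real n + 1) ^ 2 * F \<le> K * F" unfolding K_def using F0 by (intro mult_right_mono) auto
    moreover have "(2 * real M) ^ 5 * V \<le> K * V" unfolding K_def using V0 
      by (intro mult_right_mono) (auto simp: power_mult_distrib)
    ultimately show "resample_energy 0 f + (2 * real M) ^ 5 * V \<le> K * (F + V)"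
      using resample_energy_0_le[of f] unfolding F_def[symmetric] distrib_left by linarith
  qed auto
  also have "\<dots> \<le> 6 * real (M + 1) ^ 2 * (real n + 1) * (K * (T / c))"
    using T c0 by (intro mult_left_mono) (auto simp: field_simps K_def)
  also have "\<dots> = 2 * (relax * T)"
  proof -
    have "relax = 12 * (real M + 1) ^ 3 * (real n * (real n + 1)) * K" by (simp only: relax_def K_def)
    moreover have "T / c = T * (4 * (real M + 1) * real n)" by (simp add: c_def)
    ultimately show ?thesis by (simp add: power2_eq_square power3_eq_cube algebra_simps)
  qed
  finally show ?thesis by (simp add: T_def)
qed

text \<open>Each of the \<open>M + 1\<close> factors pays \<open>exp R\<close> through
  \<open>Z i\<close>, and \<open>exp (2 * n)\<close> for the binomial and for \<open>n + 1\<close>,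
  both of which are at most \<open>2 ^ n\<close>.\<close>

lemma w_ge:
  assumes G: "\<And>k. k \<le> n \<Longrightarrow> 0 \<le> G k \<and> G k \<le> R" and x: "x \<in> S"
  shows "exp (- ((real M + 1) * (R + 2 * real n))) \<le> w x"
proof -
  have R: "0 \<le> R" using G[of 0] by auto
  have "exp (- (R + 2 * real n)) \<le> rho i a" if i: "i \<le> M" and a: "a \<in> configs n" for i a
  proof -
    have "Z i \<le> (\<Sum>b\<in>configs n. exp R * base_weight n b)"
      unfolding Z_def
    proof (intro sum_mono mult_right_mono)
      fix b
      have "real i * (G (num_plus n b) / real M) \<le> real M * (R / real M)"
        using i R G num_plus_le by (intro mult_mono divide_right_mono) auto
      thus "exp (real i * (G (num_plus n b) / real M)) \<le> exp R" using M_pos by simp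
    qed (simp add: base_weight_pos less_imp_le)
    hence Z: "Z i \<le> exp R * (real n + 1)" by (simp add: sum_base_weight flip: sum_distrib_left)
    have "real (n choose num_plus n a) * (real n + 1) \<le> 2 ^ n * 2 ^ n"
    proof (intro mult_mono)
      have "n choose num_plus n a \<le> 2 ^ n" by (rule binomial_le_pow2)
      hence "real (n choose num_plus n a) \<le> real (2 ^ n)" by (simp only: of_nat_le_iff)
      thus "real (n choose num_plus n a) \<le> 2 ^ n" by simp
      have "real (Suc n) \<le> real (2 ^ n)" using less_exp[of n] by (simp only: of_nat_le_iff Suc_le_eq)
      thus "real n + 1 \<le> 2 ^ n" by simp
    qed auto
    also have "(2::real) ^ n * 2 ^ n \<le> exp 1 ^ n * exp 1 ^ n"
      using exp_ge_add_one_self[of 1] by (intro mult_mono power_mono) auto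
    also have "\<dots> = exp (2 * real n)" by (simp flip: exp_of_nat_mult exp_add)
    finally have B: "real (n choose num_plus n a) * (real n + 1) \<le> exp (2 * real n)" .
    have b: "1 / exp (2 * real n) \<le> base_weight n a / (real n + 1)"
    proof -
      note * = B
      have "0 < real (n choose num_plus n a) * (real n + 1)"
        using num_plus_le[of n a] by (intro mult_pos_pos) (auto simp: add_pos_nonneg)
      with * have "1 / exp (2 * real n) \<le> 1 / (real (n choose num_plus n a) * (real n + 1))"
        by (intro divide_left_mono) auto
      thus ?thesis by (simp add: base_weight_def)
    qed
    have "exp (- (R + 2 * real n)) = 1 / exp (2 * real n) / exp R"
      by (simp add: exp_diff exp_minus field_simps)
    also have "\<dots> \<le> base_weight n a / (real n + 1) / exp R"
      using b by (intro divide_right_mono) auto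
    also have "\<dots> = 1 * base_weight n a / (exp R * (real n + 1))" by simp
    also have "\<dots> \<le> rho i a"
      unfolding rho_def using Z Z_pos G[OF num_plus_le] base_weight_pos[of n a]
      by (intro frac_le mult_right_mono) (auto intro!: mult_nonneg_nonneg)
    finally show ?thesis .
  qed
  hence "(\<Prod>i=0..M. exp (- (R + 2 * real n))) \<le> w x"
    unfolding w_def using x by (intro prod_mono) (auto intro: S_in)
  moreover have "(\<Prod>i=0..M. exp (- (R + 2 * real n))) = exp (- ((real M + 1) * (R + 2 * real n)))"
  proof -
    have "(\<Prod>i=0..M. exp (- (R + 2 * real n))) = exp (- (R + 2 * real n)) ^ Suc M"
      by (simp only: prod_constant card_atLeastAtMost diff_zero)
    also have "\<dots> = exp (real (Suc M) * (- (R + 2 * real n)))" by (rule exp_of_nat_mult[symmetric])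
    finally show ?thesis by (simp add: algebra_simps)
  qed
  ultimately show ?thesis by simp
qed

lemma acc_flip:
  assumes "x \<in> S" "i \<le> M" "v \<in> {1..n}"
  shows "chain.acc (Inl (i, v)) x = min 1 (rho i (flip v (x i)) / rho i (x i))"
proof -
  have "w (x(i := flip v (x i))) / w x = rho i (flip v (x i)) / rho i (x i)"
    using w_upd[OF assms(2), of x "flip v (x i)"] w_pos[OF assms(1)] rho_pos[OF S_in[OF assms(1,2)], of i]
    by (simp add: field_simps)
  thus ?thesis by (simp add: chain.acc_def)
qed

text \<open>Acceptance of a flip sees \<open>G\<close> only through a difference, so the compression
  of gaps can be judged on differences alone.\<close>

lemma rho_ratio:
  "rho i a / rho i b = exp (real i / real M * (G (num_plus n a) - G (num_plus n b))) * (base_weight n a / base_weight n b)"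
proof -
  have "exp (real i / real M * (G (num_plus n a) - G (num_plus n b))) = 
    exp (real i * (G (num_plus n a) / real M)) / exp (real i * (G (num_plus n b) / real M))"
    by (simp add: algebra_simps diff_divide_distrib flip: exp_diff)
  thus ?thesis using Z_pos[of i] by (simp add: rho_def)
qed

lemma acc_swap:
  assumes "x \<in> S" "i < M"
  shows "chain.acc (Inr i) x = min 1 (exp ((G (num_plus n (x i)) - G (num_plus n (x (Suc i)))) / real M))"
  using w_sw[of i "Suc i" x] w_pos[OF assms(1)] assms by (simp add: chain.acc_def diff_divide_distrib)

end

section \<open>The transition kernel of the flat-swap chain\<close>

context metropolis_involutions
begin

context
  fixes K :: "'s \<Rightarrow> 's pmf"
  assumes K: "\<And>x f. x \<in> S \<Longrightarrow> measure_pmf.expectation (K x) f = step f x"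
begin

text \<open>The kernel is known only through expectations; testing it with the indicator of the
  complement of \<open>S\<close> recovers closedness.\<close>

lemma kernel_closed:
  assumes "x \<in> S" shows "set_pmf (K x) \<subseteq> S"
proof -
  have "step (indicator (- S)) x = 0"
    using assms act_in unfolding step_def by (simp add: indicator_def)
  hence "measure_pmf.prob (K x) (- S) = 0" using K[OF assms, of "indicator (- S)"] by simp
  thus ?thesis by (auto simp: measure_pmf_zero_iff)
qed

lemma chain_after_Suc: "chain_after K (Suc t) x = chain_after K t x \<bind> K"
  by (simp add: chain_after_def)

lemma chain_after_closed:
  assumes "x \<in> S" shows "set_pmf (chain_after K t x) \<subseteq> S"
proof (induction t)
  case 0 thus ?case using assms by (simp add: chain_after_def)
next
  case (Suc t) thus ?case using kernel_closed by (auto simp: chain_after_Suc set_bind_pmf)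
qed

text \<open>The chain grows at its end, so the last step acts on \<open>f\<close> first; this is why
  \<open>f\<close> varies in the induction.\<close>

lemma expectation_chain_after:
  assumes x: "x \<in> S" 
  shows "measure_pmf.expectation (chain_after K t x) f = (step ^^ t) f x"
proof (induction t arbitrary: f)
  case 0 thus ?case by (simp add: chain_after_def)
next
  case (Suc t)
  have "measure_pmf.expectation (chain_after K (Suc t) x) f = 
     (\<Sum>y\<in>S. pmf (chain_after K t x) y *\<^sub>R measure_pmf.expectation (K y) f)"
    unfolding chain_after_Suc using kernel_closed chain_after_closed[OF x] finite_S
    by (intro pmf_expectation_bind) (auto intro: finite_subset)
  also have "\<dots> = (\<Sum>y\<in>S. pmf (chain_after K t x) y *\<^sub>R step f y)"
    by (simp add: K)
  also have "\<dots> = measure_pmf.expectation (chain_after K t x) (step f)"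
    using finite_S chain_after_closed[OF x]
    by (intro integral_measure_pmf[symmetric]) auto
  also have "\<dots> = (step ^^ Suc t) f x" unfolding Suc by (simp add: funpow_swap1)
  finally show ?case .
qed

text \<open>The sign of the difference of the two densities is a test function attaining twice the
  distance.\<close>

lemma tv_distance_le:
  assumes x: "x \<in> S" and \<pi>: "\<And>y. y \<in> S \<Longrightarrow> \<pi> y = w y"
    and conv: "\<And>f. (\<And>y. y \<in> S \<Longrightarrow> \<bar>f y\<bar> \<le> 1) \<Longrightarrow> \<bar>(step ^^ t) f x - mean f\<bar> \<le> 2 * \<epsilon>"
  shows "tv_distance S (chain_after K t x) \<pi> \<le> \<epsilon>"
proof -
  let ?p = "pmf (chain_after K t x)"
  define f where "f y = sgn (?p y - w y)" for y
  have "measure_pmf.expectation (chain_after K t x) f = (\<Sum>y\<in>S. ?p y *\<^sub>R f y)"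
    using finite_S chain_after_closed[OF x] by (intro integral_measure_pmf) auto
  hence "(step ^^ t) f x - mean f = (\<Sum>y\<in>S. (?p y - w y) * f y)"
    unfolding expectation_chain_after[OF x] mean_def by (simp add: left_diff_distrib sum_subtractf)
  also have "\<dots> = (\<Sum>y\<in>S. \<bar>?p y - \<pi> y\<bar>)" by (simp add: f_def \<pi> linordered_idom_class.abs_sgn)
  finally show ?thesis using conv[of f] by (simp add: tv_distance_def f_def abs_sgn_eq)
qed

text \<open>Convergence at the single time \<open>T\<close> suffices: for later \<open>t\<close> the
  first \<open>t - T\<close> applications of the operator yield another test function bounded by 1
  with the same mean.\<close>

lemma mixing_time_le:
  assumes S: "S \<noteq> {}" and \<pi>: "\<And>y. y \<in> S \<Longrightarrow> \<pi> y = w y"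
    and conv: "\<And>f x. x \<in> S \<Longrightarrow> (\<And>y. y \<in> S \<Longrightarrow> \<bar>f y\<bar> \<le> 1) \<Longrightarrow> \<bar>(step ^^ T) f x - mean f\<bar> \<le> 2 * \<epsilon>"
  shows "\<exists>\<tau>. mixing_time S K \<pi> \<epsilon> = enat \<tau> \<and> \<tau> \<le> T"
proof -
  have "(MAX x\<in>S. tv_distance S (chain_after K t x) \<pi>) \<le> \<epsilon>" if t: "t \<ge> T" for t
  proof -
    have "tv_distance S (chain_after K t x) \<pi> \<le> \<epsilon>" if x: "x \<in> S" for x
    proof (rule tv_distance_le[OF x \<pi>])
      fix f :: "'s \<Rightarrow> real" assume f: "\<And>y. y \<in> S \<Longrightarrow> \<bar>f y\<bar> \<le> 1"
      have "(step ^^ t) f = (step ^^ T) ((step ^^ (t - T)) f)"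
        using t by (metis comp_apply funpow_add le_add_diff_inverse)
      thus "\<bar>(step ^^ t) f x - mean f\<bar> \<le> 2 * \<epsilon>"
        using conv[OF x, of "(step ^^ (t - T)) f"] iter_abs_le[where f = f, OF f] by (simp add: mean_iter)
    qed
    thus ?thesis using S finite_S by simp
  qed
  hence "enat T \<in> {enat t | t. \<forall>t'\<ge>t. (MAX x\<in>S. tv_distance S (chain_after K t' x) \<pi>) \<le> \<epsilon>}"
    by blast
  hence "mixing_time S K \<pi> \<epsilon> \<le> enat T" unfolding mixing_time_def by (rule Inf_lower)
  thus ?thesis by (cases "mixing_time S K \<pi> \<epsilon>") auto
qed

end
end

text \<open>Compressing every gap between consecutive values to at most \<open>L\<close> keeps all small
  differences and makes the range polynomial.\<close>

lemma compress_gaps: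
  fixes V :: "real set"
  assumes "finite V" "0 \<le> L"
  shows "\<exists>\<phi>. (\<forall>v\<in>V. 0 \<le> \<phi> v \<and> \<phi> v \<le> real (card V) * L) \<and>
    (\<forall>u\<in>V. \<forall>v\<in>V. u \<le> v \<longrightarrow> \<phi> v - \<phi> u = v - u \<or> (L \<le> \<phi> v - \<phi> u \<and> L \<le> v - u))"
  using assms(1)
proof (induction V rule: finite_linorder_max_induct)
  case (insert b A)
  then obtain \<phi> where range: "\<And>v. v \<in> A \<Longrightarrow> 0 \<le> \<phi> v \<and> \<phi> v \<le> real (card A) * L"
    and diff: "\<And>u v. u \<in> A \<Longrightarrow> v \<in> A \<Longrightarrow> u \<le> v \<Longrightarrow> \<phi> v - \<phi> u = v - u \<or> (L \<le> \<phi> v - \<phi> u \<and> L \<le> v - u)"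
    by blast
  have card: "card (insert b A) = Suc (card A)" using insert by (intro card_insert_disjoint) auto
  show ?case
  proof (cases "A = {}")
    case True
    thus ?thesis using assms(2) by (intro exI[of _ "\<lambda>_. 0"]) auto
  next
    case False
    define m where "m = Max A"
    have m: "m \<in> A" "m < b" "\<And>u. u \<in> A \<Longrightarrow> u \<le> m" using insert False by (auto simp: m_def)
    define \<phi>' where "\<phi>' = \<phi>(b := \<phi> m + min (b - m) L)"
    have old: "\<phi>' v = \<phi> v" if "v \<in> A" for v using that insert.hyps by (auto simp: \<phi>'_def)
    have new: "\<phi>' b = \<phi> m + min (b - m) L" by (simp add: \<phi>'_def)
    have "0 \<le> \<phi>' v \<and> \<phi>' v \<le> real (card (insert b A)) * L" if "v \<in> insert b A" for v
    proof (cases "v = b")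
      case True
      thus ?thesis using range[OF m(1)] m(2) assms(2) unfolding card by (simp add: new distrib_right min_def)
    next
      case False
      thus ?thesis using range[of v] old[of v] that assms(2) unfolding card by (simp add: distrib_right)
    qed
    moreover have "\<phi>' v - \<phi>' u = v - u \<or> (L \<le> \<phi>' v - \<phi>' u \<and> L \<le> v - u)"
      if uv: "u \<in> insert b A" "v \<in> insert b A" "u \<le> v" for u v
    proof (cases "v = b")
      case True
      show ?thesis
      proof (cases "u = b")
        case False
        hence u: "u \<in> A" "u \<le> m" using uv m by auto
        \<comment> \<open>If neither the gap from \<open>u\<close> to \<open>m\<close> nor the one
          from \<open>m\<close> to \<open>b\<close> was shortened, the sum is exact; otherwise one
          of them is at least \<open>L\<close> on both sides and the other is nonnegative.\<close>
        show ?thesis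
          using diff[OF u(1) m(1) u(2)] m(2) u(2) assms(2) unfolding True new old[OF u(1)] 
          by (auto simp: min_def)
      qed (use True in simp)
    next
      case False
      hence "v \<in> A" "u \<in> A" using uv insert.hyps by force+
      thus ?thesis using diff uv by (simp add: old)
    qed
    ultimately show ?thesis by blast
  qed
qed auto

section \<open>The mean-field Ising model as an instance\<close>

lemma sum_agreeing_pairs:
  assumes x: "x \<in> configs n"
  shows "2 * (\<Sum>(u, v)\<in>{(u, v). u \<in> {1..n} \<and> v \<in> {1..n} \<and> u < v}. of_bool (x u = x v)) + real n
     = real (num_plus n x) ^ 2 + real (n - num_plus n x) ^ 2"
proof -
  let ?A = "{1..n}"
  let ?P = "{v \<in> ?A. x v = 1}"
  let ?g = "\<lambda>(u, v). of_bool (x u = x v) :: real"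
  define L where "L = {(u, v). u \<in> ?A \<and> v \<in> ?A \<and> u < v}"
  define U where "U = {(u, v). u \<in> ?A \<and> v \<in> ?A \<and> v < u}"
  have fin: "finite L" "finite U" 
    by (rule finite_subset[of _ "?A \<times> ?A"], auto simp: L_def U_def)+
  have "sum ?g (?A \<times> ?A) = sum ?g (L \<union> U \<union> (\<lambda>u. (u, u)) ` ?A)"
    by (rule sum.cong) (auto simp: L_def U_def)
  also have "\<dots> = sum ?g (L \<union> U) + sum ?g ((\<lambda>u. (u, u)) ` ?A)"
    using fin by (intro sum.union_disjoint) (auto simp: L_def U_def)
  also have "sum ?g (L \<union> U) = sum ?g L + sum ?g U"
    using fin by (intro sum.union_disjoint) (auto simp: L_def U_def)
  also have "sum ?g U = sum ?g L"
    by (rule sum.reindex_bij_witness[where i = prod.swap and j = prod.swap]) (auto simp: L_def U_def)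
  also have "sum ?g ((\<lambda>u. (u, u)) ` ?A) = real n"
    by (subst sum.reindex) (auto simp: inj_on_def)
  finally have 1: "sum ?g (?A \<times> ?A) = 2 * sum ?g L + real n" by simp
  have k: "card ?P = num_plus n x" by (simp add: num_plus_def)
  have "card (?A - ?P) = card ?A - card ?P" by (intro card_Diff_subset) auto
  hence nk: "card (?A - ?P) = n - num_plus n x" using k by simp
  have row: "(\<Sum>v\<in>?A. of_bool (x u = x v)) = (if u \<in> ?P then real (num_plus n x) else real (n - num_plus n x))" 
    if u: "u \<in> ?A" for u
  proof -
    have "(\<Sum>v\<in>?A. of_bool (x u = x v)) = real (card {v \<in> ?A. x u = x v})"
      by (simp add: Int_def)
    also have "{v \<in> ?A. x u = x v} = (if u \<in> ?P then ?P else ?A - ?P)"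
      using configs_cases[OF x] u by (auto; fastforce)
    finally show ?thesis using k nk by (auto split: if_splits)
  qed
  have "sum ?g (?A \<times> ?A) = (\<Sum>u\<in>?A. \<Sum>v\<in>?A. of_bool (x u = x v))"
    by (simp only: sum.cartesian_product)
  also have "\<dots> = (\<Sum>u\<in>?A. if u \<in> ?P then real (num_plus n x) else real (n - num_plus n x))"
    by (rule sum.cong) (use row in auto)
  also have "\<dots> = (\<Sum>u\<in>?P. real (num_plus n x)) + (\<Sum>u\<in>?A - ?P. real (n - num_plus n x))"
    by (subst sum.subset_diff[of ?P ?A]) (auto intro!: arg_cong2[where f = "(+)"] sum.cong)
  also have "\<dots> = real (num_plus n x) ^ 2 + real (n - num_plus n x) ^ 2"
    using k nk by (simp add: power2_eq_square)
  finally show ?thesis using 1 by (simp add: L_def)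
qed

text \<open>The fraction is \<open>k choose 2\<close> plus \<open>(n - k) choose 2\<close>, the
  number of edges with equal spins.\<close>

definition level_energy :: "nat \<Rightarrow> real \<Rightarrow> nat \<Rightarrow> real" where
  "level_energy n h k = (real k ^ 2 + real (n - k) ^ 2 - real n) / 2 + h * real k"

lemma gibbs_weight_eq:
  "x \<in> configs n \<Longrightarrow> gibbs_weight n b h x = exp (b * level_energy n h (num_plus n x))"
  using sum_agreeing_pairs[of x n] by (simp add: gibbs_weight_def level_energy_def)

definition level_potential :: "nat \<Rightarrow> real \<Rightarrow> real \<Rightarrow> nat \<Rightarrow> real" where
  "level_potential n \<beta> h k = \<beta> * level_energy n h k + ln (real (n choose k))"

locale flat_swap_chain =
  fixes n M :: nat and \<beta> h :: real
  assumes n: "0 < n" and M: "0 < M"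
begin

sublocale flat_swap_model n M "level_potential n \<beta> h"
  by unfold_locales (fact n M)+

text \<open>The dampening exponent is \<open>i / M - 1\<close>: the part \<open>i / M\<close>
  supplies the entropy term of \<open>level_potential\<close>, and the part \<open>- 1\<close> is
  \<open>base_weight\<close>.\<close>

lemma damped_weight:
  assumes "x \<in> configs n"
  shows "gibbs_weight n (real i * \<beta> / real M) h x * dampening n M i x =
    exp (real i * (level_potential n \<beta> h (num_plus n x) / real M)) * base_weight n x"
proof -
  have c: "0 < real (n choose num_plus n x)" using num_plus_le[of n x] by simp
  have "dampening n M i x = exp (real i * ln (real (n choose num_plus n x)) / real M) * base_weight n x"
    using c M by (simp add: dampening_def base_weight_def powr_def diff_divide_distrib left_diff_distrib exp_diff)
  thus ?thesis
    using assms by (simp add: gibbs_weight_eq level_potential_def distrib_left add_divide_distrib exp_add mult_ac)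
qed

lemma damped_gibbs_eq:
  assumes "x \<in> configs n"
  shows "damped_gibbs n M \<beta> h i x = rho i x"
proof -
  let ?b = "real i * \<beta> / real M"
  define Y where "Y = (\<Sum>y\<in>configs n. gibbs_weight n ?b h y)"
  have Y: "Y > 0" unfolding Y_def
    using finite_configs \<Omega>_nonempty by (intro sum_pos) (auto simp: gibbs_weight_def)
  have g: "gibbs n ?b h y * dampening n M i y = gibbs_weight n ?b h y * dampening n M i y / Y" for y
    by (simp add: gibbs_def Y_def)
  have "(\<Sum>y\<in>configs n. gibbs n ?b h y * dampening n M i y) = (\<Sum>y\<in>configs n. gibbs_weight n ?b h y * dampening n M i y) / Y"
    unfolding g by (simp add: sum_divide_distrib)
  also have "(\<Sum>y\<in>configs n. gibbs_weight n ?b h y * dampening n M i y) = Z i"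
    unfolding Z_def by (intro sum.cong refl damped_weight)
  finally show ?thesis
    using Y by (simp add: damped_gibbs_def g damped_weight[OF assms] rho_def)
qed

lemma states_eq: "flat_swap_states n M = S"
  by (simp add: flat_swap_states_def S_def)

lemma flat_swap_dist_eq: "x \<in> S \<Longrightarrow> flat_swap_dist n M \<beta> h x = w x"
  unfolding flat_swap_dist_def w_def by (intro prod.cong refl damped_gibbs_eq) (auto intro: S_in)

lemma expectation_bind_pmf_of_set:
  fixes f :: "'z \<Rightarrow> real"
  assumes "A \<noteq> {}" "finite A" "\<And>a. a \<in> A \<Longrightarrow> finite (set_pmf (F a))"
  shows "measure_pmf.expectation (pmf_of_set A \<bind> F) f = (\<Sum>a\<in>A. measure_pmf.expectation (F a) f) / real (card A)"
  using pmf_expectation_bind_pmf_of_set[of A F f, OF assms]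
  by (simp add: divide_inverse mult.commute flip: sum_distrib_left)

lemma expectation_bernoulli_return:
  fixes f :: "'z \<Rightarrow> real" assumes "0 \<le> p" "p \<le> 1"
  shows "measure_pmf.expectation (bernoulli_pmf p \<bind> (\<lambda>a. return_pmf (if a then y else x))) f
     = f x + p * (f y - f x)"
  using assms by (simp add: algebra_simps flip: map_pmf_def)

lemma expectation_metropolis:
  assumes x: "x \<in> configs n" and \<rho>: "\<And>y. y \<in> configs n \<Longrightarrow> 0 < \<rho> y"
  shows "measure_pmf.expectation (metropolis n \<rho> x) f =
    f x + (\<Sum>v\<in>{1..n}. 1 / (2 * real n) * min 1 (\<rho> (flip v x) / \<rho> x) * (f (flip v x) - f x))"
proof -
  have n': "{1..n} \<noteq> {}" using n by auto
  have signs: "{1, - 1 :: int} \<noteq> {}" "finite {1, - 1 :: int}" by auto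
  let ?a = "\<lambda>v. min 1 (\<rho> (flip v x) / \<rho> x)"
  have inner: "measure_pmf.expectation (pmf_of_set {1, - 1} \<bind> (\<lambda>s. bernoulli_pmf (min 1 (\<rho> (x(v := s)) / \<rho> x)) \<bind>
      (\<lambda>a. return_pmf (if a then x(v := s) else x)))) f = f x + 1 / 2 * ?a v * (f (flip v x) - f x)"
    if v: "v \<in> {1..n}" for v
  proof -
    define E where "E s = f x + min 1 (\<rho> (x(v := s)) / \<rho> x) * (f (x(v := s)) - f x)" for s
    have pos: "0 \<le> \<rho> (x(v := s))" if "s \<in> {1, - 1}" for s
      using that v x configs_cases[OF x v] \<rho>[OF x] \<rho>[OF flip_in[OF x v]]
      by (intro less_imp_le \<rho>) (auto simp: configs_def PiE_iff extensional_def)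
    have "measure_pmf.expectation (pmf_of_set {1, - 1} \<bind> (\<lambda>s. bernoulli_pmf (min 1 (\<rho> (x(v := s)) / \<rho> x)) \<bind>
      (\<lambda>a. return_pmf (if a then x(v := s) else x)))) f = (\<Sum>s\<in>{1, - 1}. E s) / 2"
      using pos \<rho>[OF x] unfolding E_def
      by (subst expectation_bind_pmf_of_set[OF signs])
         (auto simp: expectation_bernoulli_return set_bind_pmf)
    \<comment> \<open>One of the two spins is the present one and leaves \<open>x\<close> fixed
      whether or not it is accepted, so a flip is proposed with probability 1/2.\<close>
    also have "\<dots> = (E (x v) + E (- x v)) / 2"
      using configs_cases[OF x v] by auto
    also have "E (x v) = f x" by (simp add: E_def)
    also have "E (- x v) = f x + ?a v * (f (flip v x) - f x)" by (simp add: E_def flip_def)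
    also have "(f x + (f x + ?a v * (f (flip v x) - f x))) / 2 = f x + 1 / 2 * ?a v * (f (flip v x) - f x)"
      by (simp add: field_simps)
    finally show ?thesis .
  qed
  have "measure_pmf.expectation (metropolis n \<rho> x) f = 
    (\<Sum>v\<in>{1..n}. f x + 1 / 2 * ?a v * (f (flip v x) - f x)) / real n"
    unfolding metropolis_def Let_def
    using n by (subst expectation_bind_pmf_of_set[OF n'])
      (auto simp: inner set_bind_pmf)
  also have "\<dots> = f x + (\<Sum>v\<in>{1..n}. 1 / (2 * real n) * ?a v * (f (flip v x) - f x))"
    using n by (simp add: sum.distrib add_divide_distrib sum_divide_distrib)
  finally show ?thesis .
qed

lemma finite_metropolis: "finite (set_pmf (metropolis n \<rho> x))"
  using n by (simp add: metropolis_def Let_def set_bind_pmf)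

lemma expectation_level_move:
  assumes x: "x \<in> S"
  shows "measure_pmf.expectation (level_move n M \<beta> h x) f =
    f x + (\<Sum>i=0..M. \<Sum>v\<in>{1..n}. 1 / (2 * (real M + 1) * real n) * chain.acc (Inl (i, v)) x * (f (act (Inl (i, v)) x) - f x))"
proof -
  have inner: "measure_pmf.expectation (metropolis n (damped_gibbs n M \<beta> h i) (x i) \<bind> (\<lambda>y. return_pmf (x(i := y)))) f =
    f x + (\<Sum>v\<in>{1..n}. 1 / (2 * real n) * chain.acc (Inl (i, v)) x * (f (act (Inl (i, v)) x) - f x))"
    if i: "i \<le> M" for i
  proof -
    note xi = S_in[OF x i]
    have "measure_pmf.expectation (metropolis n (damped_gibbs n M \<beta> h i) (x i) \<bind> (\<lambda>y. return_pmf (x(i := y)))) f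
      = measure_pmf.expectation (metropolis n (damped_gibbs n M \<beta> h i) (x i)) (\<lambda>y. f (x(i := y)))"
      by (simp flip: map_pmf_def)
    also have "\<dots> = f x + (\<Sum>v\<in>{1..n}. 1 / (2 * real n) * min 1 (damped_gibbs n M \<beta> h i (flip v (x i)) / damped_gibbs n M \<beta> h i (x i)) * (f (x(i := flip v (x i))) - f x))"
      using expectation_metropolis[OF xi, of "damped_gibbs n M \<beta> h i" "\<lambda>y. f (x(i := y))"]
      by (simp add: damped_gibbs_eq rho_pos)
    also have "\<dots> = f x + (\<Sum>v\<in>{1..n}. 1 / (2 * real n) * chain.acc (Inl (i, v)) x * (f (act (Inl (i, v)) x) - f x))"
      by (intro arg_cong2[where f = "(+)"] sum.cong refl)
         (simp add: acc_flip[OF x i] damped_gibbs_eq xi flip_in)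
    finally show ?thesis .
  qed
  have "measure_pmf.expectation (level_move n M \<beta> h x) f = 
    (\<Sum>i=0..M. f x + (\<Sum>v\<in>{1..n}. 1 / (2 * real n) * chain.acc (Inl (i, v)) x * (f (act (Inl (i, v)) x) - f x))) / (real M + 1)"
    unfolding level_move_def
    by (subst expectation_bind_pmf_of_set)
       (auto simp: inner finite_metropolis set_bind_pmf add.commute simp del: act.simps)
  also have "\<dots> = f x + (\<Sum>i=0..M. \<Sum>v\<in>{1..n}. 1 / (2 * (real M + 1) * real n) * chain.acc (Inl (i, v)) x * (f (act (Inl (i, v)) x) - f x))"
  proof -
    have "(\<Sum>i=0..M. f x) / (real M + 1) = f x" by (simp add: add_pos_nonneg add.commute)
    thus ?thesis unfolding sum.distrib add_divide_distrib sum_divide_distrib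
      by (simp add: mult_ac sum_divide_distrib del: act.simps)
  qed
  finally show ?thesis .
qed

lemma expectation_swap_move:
  assumes x: "x \<in> S"
  shows "measure_pmf.expectation (swap_move n M \<beta> h x) f =
    f x + (\<Sum>i<M. 1 / real M * chain.acc (Inr i) x * (f (act (Inr i) x) - f x))"
proof -
  let ?\<rho> = "damped_gibbs n M \<beta> h"
  let ?r = "\<lambda>i. (?\<rho> (i + 1) (x i) * ?\<rho> i (x (i + 1))) / (?\<rho> i (x i) * ?\<rho> (i + 1) (x (i + 1)))"
  have r: "min 1 (?r i) = chain.acc (Inr i) x \<and> 0 \<le> ?r i" if i: "i < M" for i
  proof -
    have xi: "x i \<in> configs n" "x (Suc i) \<in> configs n" using i by (auto intro!: S_in[OF x])
    have pos: "0 < rho i (x i) * rho (Suc i) (x (Suc i))" by (intro mult_pos_pos rho_pos xi)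
    have "w (sw i (Suc i) x) / w x = (rho i (x (Suc i)) * rho (Suc i) (x i)) / (rho i (x i) * rho (Suc i) (x (Suc i)))"
    proof -
      have "w x \<noteq> 0" "rho i (x i) * rho (Suc i) (x (Suc i)) \<noteq> 0" using w_pos[OF x] pos by auto
      from frac_eq_eq[OF this] show ?thesis
        using w_sw_rho[of i "Suc i" x] i by (simp only: mult.commute[of _ "w x"])
    qed
    hence "?r i = w (act (Inr i) x) / w x" by (simp add: damped_gibbs_eq xi mult.commute)
    moreover have "0 < w (act (Inr i) x) / w x" 
      using w_pos[OF x] w_pos[OF sw_in[OF x, of i "Suc i"]] i by simp
    ultimately show ?thesis by (simp add: chain.acc_def)
  qed
  have inner: "measure_pmf.expectation (bernoulli_pmf (min 1 (?r i)) \<bind> 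
     (\<lambda>a. return_pmf (if a then x(i := x (i + 1), i + 1 := x i) else x))) f
     = f x + chain.acc (Inr i) x * (f (act (Inr i) x) - f x)" if i: "i < M" for i
    using r[OF i] by (subst expectation_bernoulli_return) (auto simp: sw_def)
  have "measure_pmf.expectation (swap_move n M \<beta> h x) f = (\<Sum>i\<in>{0..<M}. f x + chain.acc (Inr i) x * (f (act (Inr i) x) - f x)) / real M"
    unfolding swap_move_def Let_def using M inner
    by (subst expectation_bind_pmf_of_set)
       (auto simp: set_bind_pmf simp del: act.simps)
  also have "\<dots> = f x + (\<Sum>i<M. 1 / real M * chain.acc (Inr i) x * (f (act (Inr i) x) - f x))"
    using M by (simp add: sum.distrib add_divide_distrib sum_divide_distrib atLeast0LessThan del: act.simps)
  finally show ?thesis .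
qed

lemma finite_swap_move: "finite (set_pmf (swap_move n M \<beta> h x))"
  using M by (simp add: swap_move_def Let_def set_bind_pmf)

lemma finite_level_move: "finite (set_pmf (level_move n M \<beta> h x))"
  by (simp add: level_move_def set_bind_pmf finite_metropolis)

lemma expectation_flat_swap:
  assumes x: "x \<in> S"
  shows "measure_pmf.expectation (flat_swap n M \<beta> h x) f = chain.step f x"
proof -
  have "measure_pmf.expectation (flat_swap n M \<beta> h x) f = 
    1 / 2 * measure_pmf.expectation (level_move n M \<beta> h x) f + 1 / 2 * measure_pmf.expectation (swap_move n M \<beta> h x) f"
    unfolding flat_swap_def
    by (subst pmf_expectation_bind[of UNIV]) (auto simp: finite_swap_move finite_level_move UNIV_bool)
  also have "\<dots> = f x + (1 / 2 * (\<Sum>i=0..M. \<Sum>v\<in>{1..n}. 1 / (2 * (real M + 1) * real n) * chain.acc (Inl (i, v)) x * (f (act (Inl (i, v)) x) - f x))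
      + 1 / 2 * (\<Sum>i<M. 1 / real M * chain.acc (Inr i) x * (f (act (Inr i) x) - f x)))"
    unfolding expectation_level_move[OF x] expectation_swap_move[OF x] by argo
  also have "\<dots> = chain.step f x"
    unfolding chain.step_def sum_moves rate.simps sum_distrib_left
    by (intro arg_cong2[where f = "(+)"] sum.cong refl) simp_all
  finally show ?thesis .
qed

end

section \<open>Polynomial mixing\<close>

text \<open>Below \<open>\<delta> = 1\<close>, two ratios above \<open>1 / \<delta>\<close> are both
  accepted surely, and two ratios below \<open>\<delta>\<close> are both accepted with probability
  at most \<open>\<delta>\<close>.\<close>

lemma min_one_close:
  fixes r r' \<delta> :: real
  assumes "0 < \<delta>" "0 \<le> r" "0 \<le> r'"
    and "r = r' \<or> (1 / \<delta> \<le> r \<and> 1 / \<delta> \<le> r') \<or> (r \<le> \<delta> \<and> r' \<le> \<delta>)"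
  shows "\<bar>min 1 r - min 1 r'\<bar> \<le> \<delta>"
proof (cases "\<delta> < 1")
  case True
  hence "1 < 1 / \<delta>" using assms by simp
  hence "min 1 y = 1" if "1 / \<delta> \<le> y" for y using that by simp
  moreover have "min 1 y \<le> y" for y :: real by simp
  ultimately show ?thesis using assms by (auto simp: abs_le_iff intro: min.coboundedI2 order_trans)
qed (use assms in \<open>auto simp: min_def abs_if\<close>)

text \<open>A difference of at least \<open>L\<close> at a level \<open>i \<ge> 1\<close>
  contributes a factor at least \<open>exp (L / M)\<close> or at most its inverse; the ratio of base
  weights can offset this by at most \<open>n\<close>.\<close>

lemma flat_swap_acc_close:
  fixes G G' :: "nat \<Rightarrow> real"
  assumes n: "0 < n" and M: "0 < M" and L: "0 \<le> L"
    and rel: "\<And>k k'. k \<le> n \<Longrightarrow> k' \<le> n \<Longrightarrow> G k' - G k = G' k' - G' k \<or> 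
      (L \<le> G k' - G k \<and> L \<le> G' k' - G' k) \<or> (G k' - G k \<le> - L \<and> G' k' - G' k \<le> - L)"
  shows "metropolis_pair (flat_swap_states n M) (flat_swap_model.moves n M) flat_swap_model.act
    (flat_swap_model.rate n M) (replica_exchange.w (configs n) (base_weight n) (\<lambda>a. G (num_plus n a) / real M) M)
    (replica_exchange.w (configs n) (base_weight n) (\<lambda>a. G' (num_plus n a) / real M) M)
    (real n * exp (- (L / real M)))"
proof -
  define \<delta> where "\<delta> = real n * exp (- (L / real M))"
  interpret a: flat_swap_model n M G by unfold_locales (fact n M)+
  interpret b: flat_swap_model n M G' by unfold_locales (fact n M)+
  have S: "flat_swap_states n M = a.S" by (simp add: flat_swap_states_def a.S_def)
  have \<delta>0: "0 < \<delta>" using n by (simp add: \<delta>_def)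
  have inv\<delta>: "1 / \<delta> = exp (L / real M) / real n" using n by (simp add: \<delta>_def exp_minus field_simps)
  have close: "\<bar>min 1 (exp (real i / real M * d) * q) - min 1 (exp (real i / real M * d') * q)\<bar> \<le> \<delta>"
    if q: "1 / real n \<le> q" "q \<le> real n" 
      and dd: "d = d' \<or> (L \<le> d \<and> L \<le> d') \<or> (d \<le> - L \<and> d' \<le> - L)" for i q d d'
  \<comment> \<open>At level 0 the exponent vanishes and both probabilities agree; otherwise
    \<open>i / M\<close> is at least \<open>1 / M\<close>.\<close>
  proof (cases "i = 0 \<or> d = d'")
    case True
    thus ?thesis using \<delta>0 by auto
  next
    case False
    have q0: "0 \<le> q" using q(1) n by (smt (verit) divide_nonneg_nonneg of_nat_0_le_iff)
    have lower: "1 / \<delta> \<le> exp (real i / real M * y) * q" if "L \<le> y" for y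
    proof -
      have "1 / real M * L \<le> real i / real M * y"
        using False that L M by (intro mult_mono divide_right_mono) auto
      thus ?thesis unfolding inv\<delta> using mult_mono[of "exp (L / real M)" "exp (real i / real M * y)" "1 / real n" q] q n
        by simp
    qed
    have upper: "exp (real i / real M * y) * q \<le> \<delta>" if "y \<le> - L" for y
    proof -
      have "1 / real M * L \<le> real i / real M * (- y)"
        using False that L M by (intro mult_mono divide_right_mono) auto
      hence "exp (real i / real M * y) \<le> exp (- (L / real M))" by simp
      thus ?thesis unfolding \<delta>_def using mult_mono[of "exp (real i / real M * y)" "exp (- (L / real M))" q "real n"] q q0
        by (simp add: mult.commute)
    qed
    show ?thesis
      using dd False lower upper q0 by (intro min_one_close \<delta>0) auto
  qed
  show ?thesis
  proof (unfold S, intro metropolis_pair.intro metropolis_pair_axioms.intro)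
    show "metropolis_involutions a.S a.moves a.act a.rate a.w" by unfold_locales
    show "metropolis_involutions a.S a.moves a.act a.rate b.w" by unfold_locales
    show "0 \<le> real n * exp (- (L / real M))" by simp
    fix e x assume e: "e \<in> a.moves" and x: "x \<in> a.S"
    show "\<bar>a.chain.acc e x - b.chain.acc e x\<bar> \<le> real n * exp (- (L / real M))"
    proof (cases e)
      case (Inl p)
      then obtain i v where p: "e = Inl (i, v)" "i \<le> M" "v \<in> {1..n}"
        using e by (cases p) (auto simp: a.moves_def)
      let ?y = "flip v (x i)"
      have xi: "x i \<in> configs n" using a.S_in[OF x p(2)] .
      have b0: "0 < base_weight n (x i)" "0 < base_weight n ?y" by (rule base_weight_pos)+
      have q: "base_weight n ?y / base_weight n (x i) \<le> real n" "1 / real n \<le> base_weight n ?y / base_weight n (x i)"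
        using base_weight_ratio[OF n xi p(3)] base_weight_ratio[OF n flip_in[OF xi p(3)] p(3)] b0 n
        by (auto simp: field_simps)
      show ?thesis
        unfolding p(1) a.acc_flip[OF x p(2,3)] b.acc_flip[OF x p(2,3)] a.rho_ratio b.rho_ratio \<delta>_def[symmetric]
        using q rel[OF num_plus_le num_plus_le] by (intro close) auto
    next
      case (Inr i)
      hence i: "i < M" using e by (auto simp: a.moves_def)
      let ?k = "num_plus n (x (Suc i))" and ?k' = "num_plus n (x i)"
      have r: "G ?k' - G ?k = G' ?k' - G' ?k \<or> (L \<le> G ?k' - G ?k \<and> L \<le> G' ?k' - G' ?k) \<or> 
          (G ?k' - G ?k \<le> - L \<and> G' ?k' - G' ?k \<le> - L)"
        by (intro rel num_plus_le)
      have "1 / real n \<le> 1" "1 \<le> real n" using n by auto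
      \<comment> \<open>A swap of neighbours has exponent \<open>d / M\<close> and no base weights:
        the case \<open>i = 1\<close>, \<open>q = 1\<close>.\<close>
      from close[OF this r, of 1] show ?thesis
        unfolding Inr a.acc_swap[OF x i] b.acc_swap[OF x i] \<delta>_def[symmetric] by simp
    qed
  qed
qed

context flat_swap_model
begin

text \<open>\<open>G\<close> takes at most \<open>n + 1\<close> values, so compression leaves a
  range of at most \<open>(n + 1) * L\<close>. \<open>T1\<close> makes the compressed chain converge
  within \<open>\<epsilon> / 2\<close>, counted twice in the transfer; \<open>T2\<close> bounds the
  discrepancy of the kernels by a further \<open>\<epsilon>\<close>.\<close>

lemma converges:
  assumes L: "0 \<le> L" and \<epsilon>: "0 < \<epsilon>"
    and T1: "4 * relax * ((real M + 1) * ((real n + 1) * L + 2 * real n) + 2 * ln (2 / \<epsilon>)) \<le> real T"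
    and T2: "4 * (real n * exp (- (L / real M))) * real T \<le> \<epsilon>"
    and x: "x \<in> S" and f: "\<And>y. y \<in> S \<Longrightarrow> \<bar>f y\<bar> \<le> 1"
  shows "\<bar>(chain.step ^^ T) f x - chain.mean f\<bar> \<le> 2 * \<epsilon>"
proof -
  define V where "V = G ` {..n}"
  have "finite V" by (simp add: V_def)
  have "card V \<le> n + 1" unfolding V_def using card_image_le[of "{..n}" G] by simp
  hence cardV: "real (card V) * L \<le> (real n + 1) * L" using L by (intro mult_right_mono) auto
  obtain \<phi> where range: "\<forall>v\<in>V. 0 \<le> \<phi> v \<and> \<phi> v \<le> real (card V) * L" 
    and diff: "\<forall>u\<in>V. \<forall>v\<in>V. u \<le> v \<longrightarrow> \<phi> v - \<phi> u = v - u \<or> (L \<le> \<phi> v - \<phi> u \<and> L \<le> v - u)"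
    using compress_gaps[OF \<open>finite V\<close> L] by blast
  define G' where "G' k = \<phi> (G k)" for k
  have rel: "G k' - G k = G' k' - G' k \<or> (L \<le> G k' - G k \<and> L \<le> G' k' - G' k) \<or> (G k' - G k \<le> - L \<and> G' k' - G' k \<le> - L)"
    if "k \<le> n" "k' \<le> n" for k k'
  proof -
    have V: "G k \<in> V" "G k' \<in> V" using that by (auto simp: V_def)
    show ?thesis
    proof (cases "G k \<le> G k'")
      case True
      with diff V have "\<phi> (G k') - \<phi> (G k) = G k' - G k \<or> (L \<le> \<phi> (G k') - \<phi> (G k) \<and> L \<le> G k' - G k)" by blast
      thus ?thesis unfolding G'_def by linarith
    next
      case False
      hence "G k' \<le> G k" by simp
      with diff V have "\<phi> (G k) - \<phi> (G k') = G k - G k' \<or> (L \<le> \<phi> (G k) - \<phi> (G k') \<and> L \<le> G k - G k')" by blast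
      thus ?thesis unfolding G'_def by linarith
    qed
  qed
  interpret b: flat_swap_model n M G' by unfold_locales (fact n_pos M_pos)+
  have S: "flat_swap_states n M = S" by (simp add: flat_swap_states_def S_def)
  interpret pair: metropolis_pair S moves act rate w b.w "real n * exp (- (L / real M))"
    using flat_swap_acc_close[OF n_pos M_pos L rel] unfolding S .
  have "\<bar>(b.chain.step ^^ T) f y - b.chain.mean f\<bar> \<le> \<epsilon> / 2" if y: "y \<in> S" for y
  proof -
    define B where "B = (real M + 1) * ((real n + 1) * L + 2 * real n)"
    have "0 \<le> G' k \<and> G' k \<le> (real n + 1) * L" if "k \<le> n" for k
    proof -
      have "G k \<in> V" using that by (simp add: V_def)
      with range have "0 \<le> G' k" "G' k \<le> real (card V) * L" by (auto simp: G'_def)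
      with cardV show ?thesis by linarith
    qed
    hence "exp (- B) \<le> b.w y" unfolding B_def using y by (rule b.w_ge)
    hence "\<bar>(b.chain.step ^^ T) f y - b.chain.mean f\<bar> \<le> exp ((B - real T / (4 * relax)) / 2)"
      using b.chain.iter_converges[OF b.chain_poincare b.relax_ge_1, of y B f T] y f 
      by (simp add: b.relax_def relax_def)
    also have "\<dots> \<le> exp (- ln (2 / \<epsilon>))"
    proof -
      have "(4 * relax) * (B + 2 * ln (2 / \<epsilon>)) \<le> real T" using T1 by (simp add: B_def)
      hence "B + 2 * ln (2 / \<epsilon>) \<le> real T / (4 * relax)" using relax_ge_1 by (simp add: pos_le_divide_eq mult.commute)
      thus ?thesis by simp
    qed
    also have "\<dots> = \<epsilon> / 2" using \<epsilon> by (simp add: exp_minus)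
    finally show ?thesis .
  qed
  from pair.iter_converges[OF this f x] T2 show ?thesis by (simp add: mult_ac)
qed

end

section \<open>Explicit bounds with real arguments, so that a polynomial in \<open>n\<close> can
  replace \<open>M\<close>\<close>

definition relax_poly :: "real \<Rightarrow> real \<Rightarrow> real" where
  "relax_poly N m = 12 * (m + 1) ^ 3 * (N * (N + 1)) * (12 * (N + 1) ^ 2 + 32 * m ^ 5)"

text \<open>For \<open>L = m * u\<close> the step count is at most
  \<open>steps_factor N m * (1 + u) / \<epsilon>\<close>; the final 1 pays for rounding up.\<close>

definition steps_factor :: "real \<Rightarrow> real \<Rightarrow> real" where
  "steps_factor N m = 4 * relax_poly N m * ((m + 1) * (N + 1) * (m + 2) + 4) + 1"

text \<open>The step count of \<open>choose_steps\<close> with \<open>u\<close> replaced by its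
  upper bound and \<open>ln (2 / \<epsilon>)\<close> by \<open>1 + l\<close>, plus 1 for
  rounding.\<close>

definition mixing_bound :: "real \<Rightarrow> real \<Rightarrow> real \<Rightarrow> real" where
  "mixing_bound N m l = 4 * relax_poly N m * 
     ((m + 1) * ((N + 1) * (m * (16 * N * steps_factor N m + 4 * l)) + 2 * N) + 2 * (1 + l)) + 1"

lemma relax_poly_mono: "0 \<le> N \<Longrightarrow> 0 \<le> m \<Longrightarrow> m \<le> m' \<Longrightarrow> relax_poly N m \<le> relax_poly N m'"
  unfolding relax_poly_def by (intro mult_mono add_mono power_mono order_refl) auto

lemma relax_poly_nonneg: "0 \<le> N \<Longrightarrow> 0 \<le> m \<Longrightarrow> 0 \<le> relax_poly N m"
  unfolding relax_poly_def by auto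

lemma steps_factor_mono:
  assumes "0 \<le> N" "0 \<le> m" "m \<le> m'" shows "steps_factor N m \<le> steps_factor N m'"
  unfolding steps_factor_def using assms relax_poly_nonneg[of N m] relax_poly_nonneg[of N m'] 
  by (intro mult_mono add_mono order_refl relax_poly_mono) auto

lemma steps_factor_ge_1: "0 \<le> N \<Longrightarrow> 0 \<le> m \<Longrightarrow> 1 \<le> steps_factor N m"
  unfolding steps_factor_def using relax_poly_nonneg[of N m] by auto

lemma mixing_bound_mono:
  assumes "0 \<le> N" "0 \<le> m" "m \<le> m'" "0 \<le> l" shows "mixing_bound N m l \<le> mixing_bound N m' l"
  unfolding mixing_bound_def
  using assms relax_poly_nonneg[of N m] relax_poly_nonneg[of N m'] steps_factor_ge_1[of N m] steps_factor_ge_1[of N m']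
  by (intro mult_mono add_mono order_refl relax_poly_mono steps_factor_mono) auto

text \<open>Resolves the circular choice with \<open>L = m * u\<close> and
  \<open>u = 2 * ln K\<close>. The step count is at most \<open>K0 * (1 + u) / \<epsilon>\<close>,
  hence at most \<open>2 * K0 * K / \<epsilon>\<close>, while \<open>exp u = K * K\<close>; the
  value of \<open>K\<close> is what makes the discrepancy at most \<open>\<epsilon>\<close>.
  Bounding \<open>ln (8 * N * K0)\<close> by its argument is crude but polynomial, and
  \<open>\<epsilon>\<close> enters the bound only through \<open>l\<close>.\<close>

lemma choose_steps:
  fixes N m \<epsilon> :: real
  assumes N: "1 \<le> N" and m: "1 \<le> m" and \<epsilon>: "0 < \<epsilon>" "\<epsilon> < 1"
  shows "\<exists>L T. 0 \<le> L \<and> 4 * relax_poly N m * ((m + 1) * ((N + 1) * L + 2 * N) + 2 * ln (2 / \<epsilon>)) \<le> real T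
     \<and> 4 * (N * exp (- (L / m))) * real T \<le> \<epsilon> \<and> real T \<le> mixing_bound N m (ln (1 / \<epsilon>))"
proof -
  define K0 where "K0 = steps_factor N m"
  define K where "K = 8 * N * K0 / \<epsilon>\<^sup>2"
  define u where "u = 2 * ln K"
  define l where "l = ln (1 / \<epsilon>)"
  define R where "R = relax_poly N m"
  define X where "X = 4 * R * ((m + 1) * ((N + 1) * (m * u) + 2 * N) + 2 * ln (2 / \<epsilon>))"
  define T where "T = nat \<lceil>X\<rceil>"
  have K0: "1 \<le> K0" using N m by (simp add: K0_def steps_factor_ge_1)
  have R: "0 \<le> R" using N m by (simp add: R_def relax_poly_nonneg)
  have l: "0 < l" using \<epsilon> by (simp add: l_def)
  have NK: "1 * 1 \<le> N * K0" using N K0 by (intro mult_mono) auto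
  have e2: "0 < \<epsilon>\<^sup>2" "\<epsilon>\<^sup>2 \<le> 1" using \<epsilon> by (auto simp: power_le_one)
  have K: "1 \<le> K" using NK e2 by (simp add: K_def field_simps)
  have u0: "0 \<le> u" using K by (simp add: u_def)
  have uK: "1 + u \<le> 2 * K" using ln_le_minus_one[of K] K unfolding u_def by linarith
  have expu: "exp u = K * K" using K by (simp add: u_def exp_double power2_eq_square)
  have pos: "0 < 8 * N * K0" using N K0 by (intro mult_pos_pos) auto
  have u_le: "u \<le> 16 * N * K0 + 4 * l"
  proof -
    have "ln K = ln (8 * N * K0) - ln (\<epsilon>\<^sup>2)" unfolding K_def using pos e2(1) by (rule ln_divide_pos)
    also have "ln (\<epsilon>\<^sup>2) = - (2 * l)" using \<epsilon> by (simp add: l_def ln_realpow ln_div)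
    finally have "u = 2 * ln (8 * N * K0) + 4 * l" by (simp add: u_def)
    moreover have "ln (8 * N * K0) \<le> 8 * N * K0" using ln_le_minus_one[OF pos] by simp
    ultimately show ?thesis by (simp add: mult_ac)
  qed
  have ln2: "ln (2 / \<epsilon>) \<le> 1 + l" "ln (2 / \<epsilon>) \<le> 2 / \<epsilon>" "0 \<le> ln (2 / \<epsilon>)"
    using \<epsilon> ln_le_minus_one[of 2] ln_le_minus_one[of "2 / \<epsilon>"] by (auto simp: l_def ln_div)
  have X0: "0 \<le> X" unfolding X_def using R m N u0 ln2 by (intro mult_nonneg_nonneg add_nonneg_nonneg) auto
  have T: "X \<le> real T" "real T \<le> X + 1" unfolding T_def using X0 by linarith+
  have T_le: "real T \<le> mixing_bound N m l"
  proof -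
    have "X \<le> 4 * R * ((m + 1) * ((N + 1) * (m * (16 * N * K0 + 4 * l)) + 2 * N) + 2 * (1 + l))"
      unfolding X_def using R m N u0 ln2 u_le by (intro mult_left_mono add_mono) auto
    thus ?thesis using T(2) by (simp add: mixing_bound_def R_def K0_def)
  qed
  have T_le': "real T \<le> K0 * (1 + u) / \<epsilon>"
  proof -
    have "X \<le> 4 * R * ((m + 1) * ((N + 1) * ((m + 2) * (1 + u))) + 4 * (1 + u)) * (1 / \<epsilon>)"
    proof -
      have "(N + 1) * (m * u) + 2 * N \<le> (N + 1) * ((m + 2) * (1 + u))"
        using N m u0 by (simp add: algebra_simps add_nonneg_nonneg)
      hence 1: "(m + 1) * ((N + 1) * (m * u) + 2 * N) \<le> (m + 1) * ((N + 1) * ((m + 2) * (1 + u)))"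
        using m by (intro mult_left_mono) auto
      have "(m + 1) * ((N + 1) * ((m + 2) * (1 + u))) * 1 \<le> (m + 1) * ((N + 1) * ((m + 2) * (1 + u))) * (1 / \<epsilon>)"
        using \<epsilon> m N u0 by (intro mult_left_mono) auto
      moreover have "2 * ln (2 / \<epsilon>) \<le> 4 * (1 / \<epsilon>)" using ln2(2) by simp
      moreover have "4 * (1 / \<epsilon>) \<le> 4 * (1 + u) * (1 / \<epsilon>)" using u0 \<epsilon> by (intro mult_right_mono) auto
      ultimately have "(m + 1) * ((N + 1) * (m * u) + 2 * N) + 2 * ln (2 / \<epsilon>) \<le> 
          ((m + 1) * ((N + 1) * ((m + 2) * (1 + u))) + 4 * (1 + u)) * (1 / \<epsilon>)"
        using 1 unfolding distrib_right by linarith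
      thus ?thesis unfolding X_def mult.assoc using R by (intro mult_left_mono) auto
    qed
    also have "\<dots> = (K0 - 1) * (1 + u) * (1 / \<epsilon>)"
      unfolding K0_def steps_factor_def R_def[symmetric] by (simp only: algebra_simps)
    finally have "X \<le> (K0 - 1) * (1 + u) * (1 / \<epsilon>)" .
    moreover have "1 * 1 \<le> (1 + u) * (1 / \<epsilon>)" using u0 \<epsilon> by (intro mult_mono) auto
    ultimately have "X + 1 \<le> K0 * (1 + u) * (1 / \<epsilon>)" by (simp add: algebra_simps)
    thus ?thesis using T(2) by simp
  qed
  have "4 * N * real T \<le> 4 * N * (K0 * (2 * K) / \<epsilon>)"
    using T_le' uK K0 \<epsilon> N by (intro mult_left_mono) (auto intro!: order_trans[OF T_le'] divide_right_mono)
  also have "\<dots> = \<epsilon> * exp u" unfolding expu using \<epsilon> by (simp add: K_def power2_eq_square field_simps)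
  finally have T2: "4 * (N * exp (- u)) * real T \<le> \<epsilon>" by (simp add: exp_minus field_simps)
  show ?thesis
    using u0 m T(1) T2 T_le by (intro exI[of _ "m * u"] exI[of _ T]) (auto simp: X_def R_def l_def)
qed

lemma (in flat_swap_chain) mixing_time_le_mixing_bound:
  assumes \<epsilon>: "0 < \<epsilon>" "\<epsilon> < 1"
  shows "\<exists>\<tau>. mixing_time (flat_swap_states n M) (flat_swap n M \<beta> h) (flat_swap_dist n M \<beta> h) \<epsilon> = enat \<tau>
     \<and> real \<tau> \<le> mixing_bound (real n) (real M) (ln (1 / \<epsilon>))"
proof -
  have nM: "1 \<le> real n" "1 \<le> real M" using n M by auto
  have relax: "relax = relax_poly (real n) (real M)" by (simp add: relax_def relax_poly_def)
  obtain L T where L: "0 \<le> L" 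
    and T: "4 * relax * ((real M + 1) * ((real n + 1) * L + 2 * real n) + 2 * ln (2 / \<epsilon>)) \<le> real T"
      "4 * (real n * exp (- (L / real M))) * real T \<le> \<epsilon>" "real T \<le> mixing_bound (real n) (real M) (ln (1 / \<epsilon>))"
    using choose_steps[OF nM \<epsilon>] unfolding relax by blast
  have "S \<noteq> {}" using sum_w by auto
  then obtain \<tau> where "mixing_time S (flat_swap n M \<beta> h) (flat_swap_dist n M \<beta> h) \<epsilon> = enat \<tau>" "\<tau> \<le> T"
    using chain.mixing_time_le[of "flat_swap n M \<beta> h" "flat_swap_dist n M \<beta> h" T \<epsilon>, OF expectation_flat_swap]
      flat_swap_dist_eq converges[OF L \<epsilon>(1) T(1,2)] by blast
  moreover from this have "real \<tau> \<le> real T" by simp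
  ultimately show ?thesis using T(3) unfolding states_eq by fastforce
qed

text \<open>Closure under sums, products and powers yields the polynomial from the shape of the
  bound, without expanding it.\<close>

definition poly_fun2 :: "(real \<Rightarrow> real \<Rightarrow> real) \<Rightarrow> bool" where
  "poly_fun2 F \<longleftrightarrow> (\<exists>p. \<forall>a b. poly_eval2 p a b = F a b)"

lemma poly_fun2_const: "poly_fun2 (\<lambda>a b. c)"
  unfolding poly_fun2_def by (rule exI[of _ "[:[:c:]:]"]) (simp add: poly_eval2_def)

lemma poly_fun2_fst: "poly_fun2 (\<lambda>a b. a)"
  unfolding poly_fun2_def by (rule exI[of _ "[:0, 1:]"]) (simp add: poly_eval2_def)

lemma poly_fun2_snd: "poly_fun2 (\<lambda>a b. b)"
  unfolding poly_fun2_def by (rule exI[of _ "[:[:0, 1:]:]"]) (simp add: poly_eval2_def)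

lemma poly_fun2_add: 
  assumes "poly_fun2 F" "poly_fun2 F'" shows "poly_fun2 (\<lambda>a b. F a b + F' a b)"
proof -
  obtain p p' where "\<forall>a b. poly_eval2 p a b = F a b" "\<forall>a b. poly_eval2 p' a b = F' a b"
    using assms by (auto simp: poly_fun2_def)
  thus ?thesis unfolding poly_fun2_def by (intro exI[of _ "p + p'"]) (simp add: poly_eval2_def)
qed

lemma poly_fun2_mult: 
  assumes "poly_fun2 F" "poly_fun2 F'" shows "poly_fun2 (\<lambda>a b. F a b * F' a b)"
proof -
  obtain p p' where "\<forall>a b. poly_eval2 p a b = F a b" "\<forall>a b. poly_eval2 p' a b = F' a b"
    using assms by (auto simp: poly_fun2_def)
  thus ?thesis unfolding poly_fun2_def by (intro exI[of _ "p * p'"]) (simp add: poly_eval2_def)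
qed

lemma poly_fun2_power: "poly_fun2 F \<Longrightarrow> poly_fun2 (\<lambda>a b. F a b ^ k)"
  by (induction k) (auto intro: poly_fun2_const poly_fun2_mult)

lemma poly_fun2_poly: "poly_fun2 (\<lambda>a b. poly q a)"
  by (induction q) (auto intro!: poly_fun2_const poly_fun2_add poly_fun2_mult poly_fun2_fst)

theorem theorem6p1:
  fixes q :: "real poly"
  shows "\<exists>p :: real poly poly. \<forall>(n::nat) (M::nat) (\<beta>::real) (h::real) (\<epsilon>::real).
     n \<ge> 2 \<longrightarrow> \<beta> > 0 \<longrightarrow> M \<ge> 1 \<longrightarrow> real M \<le> poly q (real n) \<longrightarrow> 0 < \<epsilon> \<longrightarrow> \<epsilon> < 1 \<longrightarrow>
     (\<exists>\<tau>::nat. mixing_time (flat_swap_states n M) (flat_swap n M \<beta> h) (flat_swap_dist n M \<beta> h) \<epsilon>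
                 = enat \<tau>
             \<and> real \<tau> \<le> poly_eval2 p (real n) (ln (1 / \<epsilon>)))"
proof -
  \<comment> \<open>The polynomial is built from \<open>q\<close> alone, before \<open>n\<close>,
    \<open>M\<close>, \<open>\<beta>\<close>, \<open>h\<close> and \<open>\<epsilon>\<close> are
    fixed.\<close>
  have "poly_fun2 (\<lambda>a b. mixing_bound a (poly q a) b)"
    unfolding mixing_bound_def steps_factor_def relax_poly_def
    by (intro poly_fun2_const poly_fun2_add poly_fun2_mult poly_fun2_power poly_fun2_fst poly_fun2_snd poly_fun2_poly)
  then obtain p where p: "\<And>a b. poly_eval2 p a b = mixing_bound a (poly q a) b"
    by (auto simp: poly_fun2_def)
  show ?thesis
  proof (intro exI[of _ p] allI impI)
    fix n M :: nat and \<beta> h \<epsilon> :: real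
    assume asm: "n \<ge> 2" "M \<ge> 1" "real M \<le> poly q (real n)" "0 < \<epsilon>" "\<epsilon> < 1"
    interpret flat_swap_chain n M \<beta> h using asm by unfold_locales auto
    obtain \<tau> where "mixing_time (flat_swap_states n M) (flat_swap n M \<beta> h) (flat_swap_dist n M \<beta> h) \<epsilon> = enat \<tau>"
      "real \<tau> \<le> mixing_bound (real n) (real M) (ln (1 / \<epsilon>))"
      using mixing_time_le_mixing_bound[OF asm(4,5)] by blast
    \<comment> \<open>The bound on \<open>M\<close> enters here, through monotonicity in the second
      argument.\<close>
    moreover have "mixing_bound (real n) (real M) (ln (1 / \<epsilon>)) \<le> poly_eval2 p (real n) (ln (1 / \<epsilon>))"
      unfolding p using asm by (intro mixing_bound_mono) auto
    ultimately show "\<exists>\<tau>. mixing_time (flat_swap_states n M) (flat_swap n M \<beta> h) (flat_swap_dist n M \<beta> h) \<epsilon> = enat \<tau>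
             \<and> real \<tau> \<le> poly_eval2 p (real n) (ln (1 / \<epsilon>))"
      by (intro exI[of _ \<tau>]) auto
  qed
qed

end
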